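(* Let $q$ be a prime power, $4\le h\le k$ integers, and $$D_1=\Bigl\{(x_1,\ldots,x_k)\in\mathbb{F}_q^k\setminus\{0\}:\Bigl(\sum_{i=1}^h x_i\Bigr)\prod_{i=1}^h x_i=0\Bigr\},\qquad n=\#D_1=q^{k-h-1}\bigl(q^{h+1}-(q-1)^{h+1}+(-1)^h(q-1)\bigr)-1.$$ For $1\le s\le h$ and positive integers $r_1,\ldots,r_l$ with $r_1+\cdots+r_l=s$, set $$Y_{s;r_1,\ldots,r_l}=n-q^{k-1}+(q-1)^{h-s}q^{k-h}\psi_s-q^{k-h}A_{r_1,\ldots,r_l,h-s}+1,\qquad X=n-q^{k-h-1}\bigl(q^h+\psi_h-(q-1)^h\bigr)+1.$$ Then the weight spectrum (set of nonzero weights) of $\mathrm{C}_{D_1}$ is $\{X\}\cup\{Y_{s;r_1,\ldots,r_l}\}$, with $s$ ranging over $1,\ldots,h$ and $(r_1,\ldots,r_l)$ over partitions of $s$. More precisely, the nonzero codewords of $\mathrm{C}_{D_1}$ split as follows: exactly $q^k-q^h$ of them (those coming from linear forms $\sum_i\alpha_ix_i$ with $(\alpha_{h+1},\ldots,\alpha_k)\ne0$) have weight $X$; and for each $s\in\{1,\ldots,h\}$ and each partition $\{r_1,\ldots,r_l\}$ of $s$ into $l$ positive parts, of type $(i_1,\ldots,i_j)$, there are $$\binom{h}{s}\binom{s}{r_1;\ldots;r_l}\binom{l}{i_1;\ldots;i_j}\binom{q-1}{l}$$ further nonzero codewords, each of weight $Y_{s;r_1,\ldots,r_l}$.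
   Context: For a finite ordered (multi)set $D=\{P_1,\ldots,P_n\}\subseteq\mathbb{F}_q^k$, the linear code $\mathrm{C}_D$ is $\{(f(P_1),\ldots,f(P_n)): f:\mathbb{F}_q^k\to\mathbb{F}_q \text{ linear}\}$; weights are Hamming weights. For $m\ge0$, $\psi_m$ is the number of $(x_1,\ldots,x_m)\in\mathbb{F}_q^m$ with $\sum x_i=0$ and all $x_i\ne 0$; $\varphi_m$ is the number with $\sum x_i=1$ and all $x_i\ne0$ ($\psi_0=1,\varphi_0=0$). For positive integers define $A_{r_1}=\psi_{r_1}$, $A_{r_1,\ldots,r_m}=\psi_{r_1+\cdots+r_{m-1}}\varphi_{r_m}+(-1)^{r_m}A_{r_1,\ldots,r_{m-1}}$ ($m\ge2$), and $A_{r_1,\ldots,r_l,0}:=A_{r_1,\ldots,r_l}$. A tuple $r_1,\ldots,r_l$ is of type $(i_1,\ldots,i_j)$ if exactly $j$ distinct values occur among $r_1,\ldots,r_l$, repeated $i_1,\ldots,i_j$ times respectively. $\binom{s}{r_1;\ldots;r_l}$ and $\binom{l}{i_1;\ldots;i_j}$ are multinomial coefficients.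
   Formalization: In the weight spectrum, X is included only when h<k, and Y_{s;r_1,…,r_l} only for partitions with l ≤ q−1; otherwise no codewords belong to them and the listed value need not be a weight (e.g. q=3, h=k=4 makes X non-integral). *)

theory Defs
  imports "HOL-Library.FuncSet" "HOL-Library.Multiset" Complex_Main
begin

(* Vectors of F_q^k: functions nat => 'a vanishing from index k on; coordinate i+1 of
   the paper is index i here. *)
definition vecs :: "nat \<Rightarrow> (nat \<Rightarrow> 'a::zero) set" where
  "vecs k = {x. \<forall>i\<ge>k. x i = 0}"

definition psi :: "'a::{finite,field} itself \<Rightarrow> nat \<Rightarrow> int" where
  "psi T m = int (card {x \<in> ({..<m} \<rightarrow>\<^sub>E (UNIV::'a set)).
        (\<Sum>i<m. x i) = 0 \<and> (\<forall>i<m. x i \<noteq> 0)})"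

definition phi :: "'a::{finite,field} itself \<Rightarrow> nat \<Rightarrow> int" where
  "phi T m = int (card {x \<in> ({..<m} \<rightarrow>\<^sub>E (UNIV::'a set)).
        (\<Sum>i<m. x i) = 1 \<and> (\<forall>i<m. x i \<noteq> 0)})"

(* A on the reversed list: Arev T [r_m, ..., r_1] = A_{r_1,...,r_m} *)
fun Arev :: "'a::{finite,field} itself \<Rightarrow> nat list \<Rightarrow> int" where
  "Arev T [] = 0"
| "Arev T [r] = psi T r"
| "Arev T (r # r' # rs) = psi T (sum_list (r' # rs)) * phi T r + (-1) ^ r * Arev T (r' # rs)"

definition A :: "'a::{finite,field} itself \<Rightarrow> nat list \<Rightarrow> int" where
  "A T rs = Arev T (rev rs)"

definition A_ext :: "'a::{finite,field} itself \<Rightarrow> nat list \<Rightarrow> nat \<Rightarrow> int" where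
  "A_ext T rs t = (if t = 0 then A T rs else A T (rs @ [t]))"

(* codeword of C_D associated with the linear form x |-> sum_{i<k} a_i x_i,
   indexed by the points of D (the order of D is irrelevant for weights) *)
definition codeword :: "nat \<Rightarrow> (nat \<Rightarrow> 'a::field) set \<Rightarrow> (nat \<Rightarrow> 'a) \<Rightarrow> ((nat \<Rightarrow> 'a) \<Rightarrow> 'a)" where
  "codeword k D a = restrict (\<lambda>P. \<Sum>i<k. a i * P i) D"

definition code :: "nat \<Rightarrow> (nat \<Rightarrow> 'a::field) set \<Rightarrow> ((nat \<Rightarrow> 'a) \<Rightarrow> 'a) set" where
  "code k D = codeword k D ` vecs k"

definition weight :: "(nat \<Rightarrow> 'a::field) set \<Rightarrow> ((nat \<Rightarrow> 'a) \<Rightarrow> 'a) \<Rightarrow> nat" where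
  "weight D c = card {P \<in> D. c P \<noteq> 0}"

definition D1 :: "nat \<Rightarrow> nat \<Rightarrow> (nat \<Rightarrow> 'a::field) set" where
  "D1 h k = {x \<in> vecs k. x \<noteq> (\<lambda>_. 0) \<and> (\<Sum>i<h. x i) * (\<Prod>i<h. x i) = 0}"

definition multinomial :: "nat \<Rightarrow> nat list \<Rightarrow> nat" where
  "multinomial n ks = fact n div prod_list (map fact ks)"

definition tuple_type :: "nat list \<Rightarrow> nat list" where
  "tuple_type rs = map (\<lambda>v. count (mset rs) v) (remdups rs)"

definition value_partition :: "nat \<Rightarrow> (nat \<Rightarrow> 'a::zero) \<Rightarrow> nat multiset" where
  "value_partition h a =
     image_mset (\<lambda>v. card {i. i < h \<and> a i = v}) (mset_set {a i | i. i < h \<and> a i \<noteq> 0})"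

end

(*
  A linear form a vanishes on the points of D_1 together with 0 in N(a) places, and the weight of
  its codeword is n + 1 - N(a). If a involves a coordinate beyond the first h, then on each
  solution of (sum y) (prod y) = 0 in F_q^h the form is equidistributed over the remaining
  coordinates, which gives X. Otherwise inclusion-exclusion over "all y_i nonzero" reduces N(a) to
  the number of y with all y_i nonzero and a.y = 0, and to the number J(a) of those with sum y = 0
  in addition. Splitting off a block of coordinates on which a is constant shows that J(a)
  obeys the recursion defining A, since the number of nonzero r-tuples with prescribed sum is
  phi_r + (-1)^r [sum = 0]. The frequencies come from counting maps with prescribed multiset of
  values twice: values to fibre sizes, and coordinates to values.
*)

theory Submission
  imports Defs "HOL-Combinatorics.Multiset_Permutations"
begin

section \<open>Linear equations in nonzero unknowns\<close>

text \<open>The recursion for A arises by subtracting v times the equation "sum = 0" from the form,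
  where v is its value on the block split off. The block then drops out of the second equation, and
  the coefficients a i - v left over are all nonzero, so that the number of solutions is psi,
  whatever these coefficients are. This gives the product psi * phi; the sign term corrects the
  cases in which the sum over the block has to be 0. A is defined on ordered tuples, while a form
  only yields a multiset of block sizes. Symmetry comes for free: the identification with J(a) holds
  for every enumeration of the values of a. The value 0 is treated as one more block, of size h - s
  and possibly empty. Counting forms amounts to counting codewords because the unit vectors lie in
  D_1, so a codeword determines its form. Counts are stated multiplied by q or by factorials, which
  avoids division.\<close>

lemma card_PiE_Un:
  assumes "finite I" "finite J" "I \<inter> J = {}" "finite S"
  shows "card {x \<in> (I \<union> J) \<rightarrow>\<^sub>E S. P x}
    = (\<Sum>f \<in> I \<rightarrow>\<^sub>E S. card {g \<in> J \<rightarrow>\<^sub>E S. P (\<lambda>i. if i \<in> I then f i else g i)})"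
proof -
  let ?j = "\<lambda>f g i. if i \<in> I then f i else g i"
  let ?B = "\<lambda>f. {g \<in> J \<rightarrow>\<^sub>E S. P (?j f g)}"
  have join: "?j (restrict x I) (restrict x J) = x" if "x \<in> (I \<union> J) \<rightarrow>\<^sub>E S" for x
    using that by (auto simp: fun_eq_iff PiE_def extensional_def)
  have "bij_betw (\<lambda>(f, g). ?j f g) (SIGMA f : I \<rightarrow>\<^sub>E S. ?B f) {x \<in> (I \<union> J) \<rightarrow>\<^sub>E S. P x}"
  proof (rule bij_betw_byWitness[where f' = "\<lambda>x. (restrict x I, restrict x J)"])
    show "\<forall>p\<in>SIGMA f : I \<rightarrow>\<^sub>E S. ?B f. (\<lambda>x. (restrict x I, restrict x J)) ((\<lambda>(f, g). ?j f g) p) = p"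
      using assms(3) by (auto simp: fun_eq_iff PiE_def extensional_def)
    show "\<forall>x\<in>{x \<in> (I \<union> J) \<rightarrow>\<^sub>E S. P x}. (\<lambda>(f, g). ?j f g) (restrict x I, restrict x J) = x"
      using join by auto
    show "(\<lambda>(f, g). ?j f g) ` (SIGMA f : I \<rightarrow>\<^sub>E S. ?B f) \<subseteq> {x \<in> (I \<union> J) \<rightarrow>\<^sub>E S. P x}"
      by (auto simp: PiE_def extensional_def)
    show "(\<lambda>x. (restrict x I, restrict x J)) ` {x \<in> (I \<union> J) \<rightarrow>\<^sub>E S. P x} \<subseteq> (SIGMA f : I \<rightarrow>\<^sub>E S. ?B f)"
      by (auto simp only: mem_Sigma_iff mem_Collect_eq join restrict_PiE_iff) auto
  qed
  from bij_betw_same_card[OF this, symmetric] show ?thesis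
    using assms by (simp add: finite_PiE)
qed

lemma card_PiE_singleton: "card {g \<in> {j} \<rightarrow>\<^sub>E S. P (g j)} = card {v \<in> S. P v}"
proof (rule bij_betw_same_card)
  show "bij_betw (\<lambda>g. g j) {g \<in> {j} \<rightarrow>\<^sub>E S. P (g j)} {v \<in> S. P v}"
    by (rule bij_betw_byWitness[where f' = "\<lambda>v. \<lambda>_\<in>{j}. v"])
      (auto simp: fun_eq_iff PiE_def extensional_def)
qed

lemma sum_if_disjoint:
  assumes "finite I" "finite J" "I \<inter> J = {}"
  shows "(\<Sum>i\<in>I \<union> J. F i (if i \<in> I then f i else g i)) = (\<Sum>i\<in>I. F i (f i)) + (\<Sum>i\<in>J. F i (g i))"
proof -
  have "(\<Sum>i\<in>J. F i (if i \<in> I then f i else g i)) = (\<Sum>i\<in>J. F i (g i))"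
    using assms by (intro sum.cong) auto
  then show ?thesis using assms by (simp add: sum.union_disjoint)
qed

lemma card_field_minus_zero: "card (- {0 :: 'a::{finite,field}}) = card (UNIV :: 'a set) - 1"
  by (simp add: Compl_eq_Diff_UNIV card_Diff_singleton)

text \<open>A coordinate with nonzero coefficient is determined by the others, so the only condition
  left is that the solved value lies in \<open>S\<close>. Both \<open>UNIV\<close> (no condition)
  and \<open>- {0}\<close> (a recursion) are wanted for \<open>S\<close>.\<close>

lemma card_linear_solutions_insert:
  fixes c :: "'b \<Rightarrow> 'a::{finite,field}"
  assumes "finite I" "j \<notin> I" "c j \<noteq> 0"
  shows "card {x \<in> insert j I \<rightarrow>\<^sub>E S. (\<Sum>i\<in>insert j I. c i * x i) = t}
    = card {f \<in> I \<rightarrow>\<^sub>E S. (t - (\<Sum>i\<in>I. c i * f i)) / c j \<in> S}"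
proof -
  have "card {x \<in> I \<union> {j} \<rightarrow>\<^sub>E S. (\<Sum>i\<in>I \<union> {j}. c i * x i) = t}
     = (\<Sum>f\<in>I \<rightarrow>\<^sub>E S. card {g \<in> {j} \<rightarrow>\<^sub>E S. (\<Sum>i\<in>I. c i * f i) + c j * g j = t})"
    using assms by (subst card_PiE_Un) (auto simp: sum_if_disjoint[where F = "\<lambda>i v. c i * v"] simp del: Un_insert_right)
  also have "\<dots> = (\<Sum>f\<in>I \<rightarrow>\<^sub>E S. card {v \<in> S. (\<Sum>i\<in>I. c i * f i) + c j * v = t})"
    by (rule sum.cong[OF refl card_PiE_singleton])
  also have "\<dots> = (\<Sum>f\<in>I \<rightarrow>\<^sub>E S. if (t - (\<Sum>i\<in>I. c i * f i)) / c j \<in> S then 1 else 0)"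
  proof (rule sum.cong[OF refl])
    fix f
    have "{v \<in> S. (\<Sum>i\<in>I. c i * f i) + c j * v = t} = {(t - (\<Sum>i\<in>I. c i * f i)) / c j} \<inter> S"
      using assms(3) by (auto simp: field_simps)
    then show "card {v \<in> S. (\<Sum>i\<in>I. c i * f i) + c j * v = t}
        = (if (t - (\<Sum>i\<in>I. c i * f i)) / c j \<in> S then 1 else 0)"
      by simp
  qed
  also have "\<dots> = card {f \<in> I \<rightarrow>\<^sub>E S. (t - (\<Sum>i\<in>I. c i * f i)) / c j \<in> S}"
    using assms by (simp add: sum.If_cases finite_PiE Int_def)
  finally show ?thesis by simp
qed

lemma card_linear_solutions:
  fixes c :: "'b \<Rightarrow> 'a::{finite,field}"
  assumes "finite I" "j \<in> I" "c j \<noteq> 0"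
  shows "card {x \<in> I \<rightarrow>\<^sub>E UNIV. (\<Sum>i\<in>I. c i * x i) = t} = card (UNIV :: 'a set) ^ (card I - 1)"
proof -
  have "card {x \<in> insert j (I - {j}) \<rightarrow>\<^sub>E UNIV. (\<Sum>i\<in>insert j (I - {j}). c i * x i) = t}
    = card (I - {j} \<rightarrow>\<^sub>E (UNIV :: 'a set))"
    using assms by (subst card_linear_solutions_insert) auto
  then show ?thesis
    using assms by (simp add: insert_absorb card_PiE)
qed

text \<open>Solving for the last unknown gives N_{m+1}(t) = (q-1)^m - N_m(t), so the error term
  merely changes sign at each step, starting from N_0(0) = 1 and N_0(t) = 0 otherwise. The factor q
  keeps the closed form integral.\<close>

lemma card_nonzero_solutions:
  fixes c :: "'b \<Rightarrow> 'a::{finite,field}"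
  assumes "finite I" "\<forall>i\<in>I. c i \<noteq> 0"
  shows "int (card (UNIV :: 'a set)) * int (card {x \<in> I \<rightarrow>\<^sub>E - {0}. (\<Sum>i\<in>I. c i * x i) = t})
    = (int (card (UNIV :: 'a set)) - 1) ^ card I
      + (- 1) ^ card I * (if t = 0 then int (card (UNIV :: 'a set)) - 1 else - 1)"
  using assms
proof (induction I rule: finite_induct)
  case empty
  have "{x \<in> {} \<rightarrow>\<^sub>E - {0}. (\<Sum>i\<in>{}. c i * x i) = t} = (if t = 0 then {\<lambda>_. undefined} else {})"
    by auto
  then show ?case by simp
next
  case (insert j I)
  let ?q = "int (card (UNIV :: 'a set))"
  let ?C = "{f \<in> I \<rightarrow>\<^sub>E - {0}. (\<Sum>i\<in>I. c i * f i) = t}"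
  have q1: "int (card (UNIV :: 'a set) - Suc 0) = ?q - 1"
    by (simp add: of_nat_diff Suc_leI finite_UNIV_card_ge_0)
  \<comment> \<open>The solved value vanishes exactly when \<open>f\<close> already satisfies the
    equation with the same right-hand side, so the admissible \<open>f\<close> form the complement
    of \<open>?C\<close>.\<close>
  have "{f \<in> I \<rightarrow>\<^sub>E - {0}. (t - (\<Sum>i\<in>I. c i * f i)) / c j \<in> - {0}} = (I \<rightarrow>\<^sub>E - {0}) - ?C"
    using insert.prems by auto
  moreover have "card ((I \<rightarrow>\<^sub>E - {0}) - ?C) = card (I \<rightarrow>\<^sub>E - {0 :: 'a}) - card ?C"
    using insert.hyps by (intro card_Diff_subset) (auto simp: finite_PiE)
  moreover have "card ?C \<le> card (I \<rightarrow>\<^sub>E - {0 :: 'a})"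
    using insert.hyps by (intro card_mono) (auto simp: finite_PiE)
  moreover have "int (card (I \<rightarrow>\<^sub>E - {0 :: 'a})) = (?q - 1) ^ card I"
    using insert.hyps by (simp add: card_PiE card_field_minus_zero q1)
  moreover have "card {x \<in> insert j I \<rightarrow>\<^sub>E - {0}. (\<Sum>i\<in>insert j I. c i * x i) = t}
      = card {f \<in> I \<rightarrow>\<^sub>E - {0}. (t - (\<Sum>i\<in>I. c i * f i)) / c j \<in> - {0}}"
    using insert.hyps insert.prems by (intro card_linear_solutions_insert) auto
  ultimately have "int (card {x \<in> insert j I \<rightarrow>\<^sub>E - {0}. (\<Sum>i\<in>insert j I. c i * x i) = t})
      = (?q - 1) ^ card I - int (card ?C)"
    by (simp only: of_nat_diff)
  then have "?q * int (card {x \<in> insert j I \<rightarrow>\<^sub>E - {0}. (\<Sum>i\<in>insert j I. c i * x i) = t})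
      = ?q * (?q - 1) ^ card I - ?q * int (card ?C)"
    by (simp add: right_diff_distrib)
  also have "\<dots> = ?q * (?q - 1) ^ card I - ((?q - 1) ^ card I
      + (- 1) ^ card I * (if t = 0 then ?q - 1 else - 1))"
    using insert by simp
  finally show ?case
    using insert.hyps by (simp add: algebra_simps)
qed

section \<open>The numbers \<open>psi\<close> and \<open>phi\<close>, and the joint solutions
  counted by A\<close>

lemma nonzero_functions_eq:
  "{x \<in> {..<m} \<rightarrow>\<^sub>E (UNIV :: 'a::zero set). P x \<and> (\<forall>i<m. x i \<noteq> 0)} = {x \<in> {..<m} \<rightarrow>\<^sub>E - {0}. P x}"
  by (auto simp: PiE_def)

lemma psi_closed_form:
  fixes T :: "'a::{finite,field} itself"
  shows "int (card (UNIV :: 'a set)) * psi T m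
    = (int (card (UNIV :: 'a set)) - 1) ^ m + (- 1) ^ m * (int (card (UNIV :: 'a set)) - 1)"
  using card_nonzero_solutions[of "{..<m}" "\<lambda>_. 1 :: 'a" 0]
  by (simp add: psi_def nonzero_functions_eq)

lemma phi_closed_form:
  fixes T :: "'a::{finite,field} itself"
  shows "int (card (UNIV :: 'a set)) * phi T m = (int (card (UNIV :: 'a set)) - 1) ^ m - (- 1) ^ m"
  using card_nonzero_solutions[of "{..<m}" "\<lambda>_. 1 :: 'a" 1]
  by (simp add: phi_def nonzero_functions_eq)

lemma psi_eq_phi:
  fixes T :: "'a::{finite,field} itself"
  shows "psi T m = phi T m + (- 1) ^ m"
proof -
  have "int (card (UNIV :: 'a set)) * psi T m = int (card (UNIV :: 'a set)) * (phi T m + (- 1) ^ m)"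
    unfolding distrib_left psi_closed_form phi_closed_form by (simp add: algebra_simps)
  then show ?thesis by simp
qed

text \<open>Scaling each unknown by its coefficient, and dividing by t if t is nonzero, would lead
  to one of the two defining equations. Here this is read off from the closed form, in which neither
  the coefficients nor the value of a nonzero t occur.\<close>

lemma card_nonzero_solutions_psi_phi:
  fixes c :: "'b \<Rightarrow> 'a::{finite,field}" and T :: "'a itself"
  assumes "finite I" "\<forall>i\<in>I. c i \<noteq> 0"
  shows "int (card {x \<in> I \<rightarrow>\<^sub>E - {0}. (\<Sum>i\<in>I. c i * x i) = t})
    = (if t = 0 then psi T (card I) else phi T (card I))"
proof -
  have "int (card (UNIV :: 'a set)) * int (card {x \<in> I \<rightarrow>\<^sub>E - {0}. (\<Sum>i\<in>I. c i * x i) = t})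
    = int (card (UNIV :: 'a set)) * (if t = 0 then psi T (card I) else phi T (card I))"
    unfolding card_nonzero_solutions[OF assms]
    using psi_closed_form[of T "card I"] phi_closed_form[of T "card I"] by simp
  then show ?thesis by simp
qed

text \<open>Once the unknowns on \<open>I\<close> satisfy \<open>\<Sum>(a i - v) * x i = 0\<close>, both equations prescribe the same sum
  over \<open>J\<close>; the first summand ignores whether that sum is zero, the second corrects for it.\<close>

lemma card_joint_solutions_split:
  fixes a :: "'b \<Rightarrow> 'a::{finite,field}" and T :: "'a itself"
  assumes "finite I" "finite J" "I \<inter> J = {}" "\<forall>i\<in>I. a i \<noteq> v" "\<forall>i\<in>J. a i = v"
  shows "int (card {x \<in> I \<union> J \<rightarrow>\<^sub>E - {0}. (\<Sum>i\<in>I \<union> J. x i) = 0 \<and> (\<Sum>i\<in>I \<union> J. a i * x i) = 0})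
    = psi T (card I) * phi T (card J)
      + (- 1) ^ card J * int (card {x \<in> I \<rightarrow>\<^sub>E - {0}. (\<Sum>i\<in>I. x i) = 0 \<and> (\<Sum>i\<in>I. a i * x i) = 0})"
proof -
  let ?E = "\<lambda>f. (\<Sum>i\<in>I. (a i - v) * f i) = 0"
  let ?F = "I \<rightarrow>\<^sub>E - {0 :: 'a}"
  have finF: "finite ?F" using assms by (simp add: finite_PiE)
  have E: "?E f \<longleftrightarrow> (\<Sum>i\<in>I. a i * f i) = v * (\<Sum>i\<in>I. f i)" for f
    by (simp add: left_diff_distrib sum_subtractf sum_distrib_left)
  have aJ: "(\<Sum>i\<in>J. a i * g i) = v * (\<Sum>i\<in>J. g i)" for g
    using assms(5) by (simp add: sum_distrib_left)
  have inner: "int (card {g \<in> J \<rightarrow>\<^sub>E - {0}. (\<Sum>i\<in>I. f i) + (\<Sum>i\<in>J. g i) = 0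
        \<and> (\<Sum>i\<in>I. a i * f i) + (\<Sum>i\<in>J. a i * g i) = 0})
      = (if ?E f then phi T (card J) else 0)
        + (if ?E f \<and> (\<Sum>i\<in>I. f i) = 0 then (- 1) ^ card J else 0)" for f
  proof -
    have eqs: "s + t = 0 \<and> u + v * t = 0 \<longleftrightarrow> u = v * s \<and> t = - s" for s t u :: 'a
      by (metis add_eq_0_iff add.inverse_inverse minus_mult_right)
    show ?thesis
      unfolding aJ eqs E[symmetric]
      using card_nonzero_solutions_psi_phi[of J "\<lambda>_. 1" "- (\<Sum>i\<in>I. f i)" T] assms(2)
      by (cases "?E f") (simp_all add: psi_eq_phi)
  qed
  have "int (card {x \<in> I \<union> J \<rightarrow>\<^sub>E - {0}. (\<Sum>i\<in>I \<union> J. x i) = 0 \<and> (\<Sum>i\<in>I \<union> J. a i * x i) = 0})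
    = (\<Sum>f\<in>?F. int (card {g \<in> J \<rightarrow>\<^sub>E - {0}. (\<Sum>i\<in>I. f i) + (\<Sum>i\<in>J. g i) = 0
        \<and> (\<Sum>i\<in>I. a i * f i) + (\<Sum>i\<in>J. a i * g i) = 0}))"
    unfolding card_PiE_Un[OF assms(1-3) finite] sum_if_disjoint[OF assms(1-3), where F = "\<lambda>i v. a i * v"]
      sum_if_disjoint[OF assms(1-3), where F = "\<lambda>i v. v"] of_nat_sum ..
  also have "\<dots> = int (card {f \<in> ?F. ?E f}) * phi T (card J)
      + (- 1) ^ card J * int (card {f \<in> ?F. ?E f \<and> (\<Sum>i\<in>I. f i) = 0})"
    unfolding inner sum.distrib sum.If_cases[OF finF] by (simp add: Int_def)
  \<comment> \<open>All coefficients \<open>a i - v\<close> are nonzero on \<open>I\<close>, so this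
    single equation is of the kind counted by \<open>psi\<close>.\<close>
  also have "int (card {f \<in> ?F. ?E f}) = psi T (card I)"
    using assms card_nonzero_solutions_psi_phi[of I "\<lambda>i. a i - v" 0 T] by simp
  also have "{f \<in> ?F. ?E f \<and> (\<Sum>i\<in>I. f i) = 0} = {x \<in> ?F. (\<Sum>i\<in>I. x i) = 0 \<and> (\<Sum>i\<in>I. a i * x i) = 0}"
    unfolding E by auto
  finally show ?thesis .
qed

text \<open>The head of the reversed list is the last block r_m, so the recursion peels off the
  value at the head of \<open>vs\<close>; \<open>I\<close> is generalised because the remaining
  values live on fewer coordinates. Values in \<open>vs\<close> that \<open>a\<close> does not take
  give blocks of size 0, which later admits the value 0 even if no coordinate vanishes.\<close>

lemma Arev_eq_card_joint_solutions:
  fixes a :: "'b \<Rightarrow> 'a::{finite,field}" and T :: "'a itself"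
  assumes "finite I" "distinct vs" "vs \<noteq> []" "a ` I \<subseteq> set vs"
  shows "Arev T (map (\<lambda>v. card {i \<in> I. a i = v}) vs)
    = int (card {x \<in> I \<rightarrow>\<^sub>E - {0}. (\<Sum>i\<in>I. x i) = 0 \<and> (\<Sum>i\<in>I. a i * x i) = 0})"
  using assms
proof (induction vs arbitrary: I)
  case (Cons v vs)
  show ?case
  proof (cases "vs = []")
    case True
    \<comment> \<open>With a single value the second equation is a multiple of the first, so one
      equation is left.\<close>
    then have av: "\<forall>i\<in>I. a i = v" using Cons.prems by auto
    then have "(\<Sum>i\<in>I. a i * x i) = v * (\<Sum>i\<in>I. x i)" for x
      by (simp add: sum_distrib_left)
    moreover have "{i \<in> I. a i = v} = I" using av by auto
    ultimately show ?thesis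
      using card_nonzero_solutions_psi_phi[OF Cons.prems(1), of "\<lambda>_. 1" 0 T]
      by (simp add: True cong: conj_cong)
  next
    case False
    then obtain v' vs' where vs: "vs = v' # vs'" by (cases vs) auto
    define J where "J = {i \<in> I. a i = v}"
    define I' where "I' = {i \<in> I. a i \<noteq> v}"
    have I: "I = I' \<union> J" "I' \<inter> J = {}" and fin: "finite I'" "finite J"
      using Cons.prems by (auto simp: I'_def J_def)
    have cards: "card {i \<in> I. a i = w} = card {i \<in> I'. a i = w}" if "w \<in> set vs" for w
    proof -
      have "w \<noteq> v" using that Cons.prems by auto
      then have "{i \<in> I. a i = w} = {i \<in> I'. a i = w}" by (auto simp: I'_def)
      then show ?thesis by simp
    qed
    have map: "map (\<lambda>w. card {i \<in> I. a i = w}) vs = map (\<lambda>w. card {i \<in> I'. a i = w}) vs"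
      using cards by simp
    have sub: "a ` I' \<subseteq> set vs" using Cons.prems by (auto simp: I'_def)
    have "sum_list (map (\<lambda>w. card {i \<in> I'. a i = w}) vs) = (\<Sum>w\<in>set vs. card {i \<in> I'. a i = w})"
      using Cons.prems by (simp add: sum_list_distinct_conv_sum_set)
    also have "\<dots> = card (\<Union>w\<in>set vs. {i \<in> I'. a i = w})"
      using fin by (subst card_UN_disjoint) auto
    also have "(\<Union>w\<in>set vs. {i \<in> I'. a i = w}) = I'" using sub by auto
    finally have sum: "sum_list (map (\<lambda>w. card {i \<in> I'. a i = w}) vs) = card I'" .
    have "Arev T (map (\<lambda>w. card {i \<in> I. a i = w}) (v # vs))
      = psi T (sum_list (map (\<lambda>w. card {i \<in> I'. a i = w}) vs)) * phi T (card J)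
        + (- 1) ^ card J * Arev T (map (\<lambda>w. card {i \<in> I'. a i = w}) vs)"
      unfolding list.map(2) map unfolding vs by (simp add: J_def)
    also have "\<dots> = psi T (card I') * phi T (card J) + (- 1) ^ card J
        * int (card {x \<in> I' \<rightarrow>\<^sub>E - {0}. (\<Sum>i\<in>I'. x i) = 0 \<and> (\<Sum>i\<in>I'. a i * x i) = 0})"
      unfolding sum using Cons.IH[OF fin(1) _ False sub] Cons.prems(2) by simp
    also have "\<dots> = int (card {x \<in> I \<rightarrow>\<^sub>E - {0}. (\<Sum>i\<in>I. x i) = 0 \<and> (\<Sum>i\<in>I. a i * x i) = 0})"
      unfolding I(1) by (rule card_joint_solutions_split[OF fin I(2), symmetric]) (auto simp: I'_def J_def)
    finally show ?thesis .
  qed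
qed simp

section \<open>Weights\<close>

text \<open>Passes from vectors that vanish beyond k to extensional functions, on which the counting
  lemmas work, and cuts the coordinates at h. The condition of \<open>D1\<close> sees only the first
  piece.\<close>

lemma card_vecs_split:
  assumes "h \<le> k"
  shows "card {x \<in> vecs k. P (x :: nat \<Rightarrow> 'a::{finite,zero})}
    = (\<Sum>f \<in> {..<h} \<rightarrow>\<^sub>E UNIV. card {g \<in> {h..<k} \<rightarrow>\<^sub>E UNIV.
        P (\<lambda>i. if i < h then f i else if i < k then g i else 0)})"
proof -
  let ?z = "\<lambda>y i. if i < k then y i else (0 :: 'a)"
  have I: "{..<k} = {..<h} \<union> {h..<k}" using assms by auto
  have "card {x \<in> vecs k. P x} = card {y \<in> {..<k} \<rightarrow>\<^sub>E UNIV. P (?z y)}"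
  proof (rule bij_betw_same_card)
    have z_restrict: "?z (restrict x {..<k}) = x" if "x \<in> vecs k" for x
      using that by (auto simp: vecs_def fun_eq_iff)
    have z_vecs: "?z y \<in> vecs k" for y
      by (simp add: vecs_def)
    have restrict_z: "restrict (?z y) {..<k} = y" if "y \<in> {..<k} \<rightarrow>\<^sub>E UNIV" for y
      using that by (auto simp: fun_eq_iff PiE_def extensional_def)
    show "bij_betw (\<lambda>x. restrict x {..<k}) {x \<in> vecs k. P x} {y \<in> {..<k} \<rightarrow>\<^sub>E UNIV. P (?z y)}"
    proof (rule bij_betw_byWitness[where f' = ?z])
      show "\<forall>x\<in>{x \<in> vecs k. P x}. ?z (restrict x {..<k}) = x"
        using z_restrict by blast
      show "\<forall>y\<in>{y \<in> {..<k} \<rightarrow>\<^sub>E UNIV. P (?z y)}. restrict (?z y) {..<k} = y"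
        using restrict_z by blast
      show "(\<lambda>x. restrict x {..<k}) ` {x \<in> vecs k. P x} \<subseteq> {y \<in> {..<k} \<rightarrow>\<^sub>E UNIV. P (?z y)}"
      proof (rule image_subsetI, clarify)
        fix x assume "x \<in> vecs k" "P x"
        then have "P (?z (restrict x {..<k}))" by (simp only: z_restrict)
        then show "restrict x {..<k} \<in> {..<k} \<rightarrow>\<^sub>E UNIV \<and> P (?z (restrict x {..<k}))"
          by (intro conjI) auto
      qed
      show "?z ` {y \<in> {..<k} \<rightarrow>\<^sub>E UNIV. P (?z y)} \<subseteq> {x \<in> vecs k. P x}"
        using z_vecs by blast
    qed
  qed
  also have "\<dots> = (\<Sum>f \<in> {..<h} \<rightarrow>\<^sub>E UNIV. card {g \<in> {h..<k} \<rightarrow>\<^sub>E UNIV.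
        P (?z (\<lambda>i. if i \<in> {..<h} then f i else g i))})"
    unfolding I by (rule card_PiE_Un) auto
  finally have "card {x \<in> vecs k. P x} = (\<Sum>f \<in> {..<h} \<rightarrow>\<^sub>E UNIV. card {g \<in> {h..<k} \<rightarrow>\<^sub>E UNIV.
      P (?z (\<lambda>i. if i \<in> {..<h} then f i else g i))})" .
  moreover have "?z (\<lambda>i. if i \<in> {..<h} then f i else g i)
      = (\<lambda>i. if i < h then f i else if i < k then g i else 0)" for f g :: "nat \<Rightarrow> 'a"
    using assms by (auto simp: fun_eq_iff)
  ultimately show ?thesis by (simp only:)
qed

lemma card_vecs: "card (vecs k :: (nat \<Rightarrow> 'a::{finite,zero}) set) = card (UNIV :: 'a set) ^ k"
  using card_vecs_split[of k k "\<lambda>_ :: nat \<Rightarrow> 'a. True"] by (simp add: card_PiE)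

lemma finite_vecs: "finite (vecs k :: (nat \<Rightarrow> 'a::{finite,zero}) set)"
  by (rule card_ge_0_finite) (simp add: card_vecs finite_UNIV_card_ge_0)

text \<open>The expression is nonzero exactly when no coordinate vanishes and the sum does not
  vanish either, so \<open>?B - ?C\<close> is what has to be removed from \<open>?U\<close>.
  \<open>Q\<close> stands for the equation of the form, or for no condition.\<close>

lemma card_sum_prod_zero:
  fixes Q :: "('b \<Rightarrow> 'a::{finite,field}) \<Rightarrow> bool"
  assumes "finite I"
  shows "int (card {y \<in> I \<rightarrow>\<^sub>E UNIV. Q y \<and> (\<Sum>i\<in>I. y i) * (\<Prod>i\<in>I. y i) = 0})
    = int (card {y \<in> I \<rightarrow>\<^sub>E UNIV. Q y}) - int (card {y \<in> I \<rightarrow>\<^sub>E - {0}. Q y})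
      + int (card {y \<in> I \<rightarrow>\<^sub>E - {0}. (\<Sum>i\<in>I. y i) = 0 \<and> Q y})"
    (is "int (card ?Z) = int (card ?U) - int (card ?B) + int (card ?C)")
proof -
  have fin: "finite (I \<rightarrow>\<^sub>E (S :: 'a set))" for S
    using assms by (simp add: finite_PiE)
  have sub: "?C \<subseteq> ?B" "?B - ?C \<subseteq> ?U" and Z: "?Z = ?U - (?B - ?C)"
    using assms by (auto simp: PiE_def Pi_def)
  have finU: "finite ?U" and finB: "finite ?B" using fin by simp_all
  have finC: "finite ?C" by (rule finite_subset[OF sub(1) finB])
  have BC: "card (?B - ?C) = card ?B - card ?C" "card ?C \<le> card ?B"
    by (rule card_Diff_subset[OF finC sub(1)], rule card_mono[OF finB sub(1)])
  have "card ?Z = card ?U - card (?B - ?C)" "card (?B - ?C) \<le> card ?U"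
    unfolding Z by (rule card_Diff_subset[OF finite_Diff[OF finB] sub(2)], rule card_mono[OF finU sub(2)])
  then show ?thesis using BC by linarith
qed

lemma int_card_field_minus_one:
  "int (card (UNIV :: 'a::{finite,field} set) - 1) = int (card (UNIV :: 'a set)) - 1"
  by (simp add: of_nat_diff Suc_leI finite_UNIV_card_ge_0)

text \<open>Coordinates with coefficient 0 are free, with q - 1 choices each; the others form an
  equation with nonzero coefficients. This is the source of (q-1)^(h-s) psi_s in Y.\<close>

lemma card_linear_solutions_nonzero:
  fixes a :: "'b \<Rightarrow> 'a::{finite,field}" and T :: "'a itself"
  assumes "finite I"
  shows "int (card {x \<in> I \<rightarrow>\<^sub>E - {0}. (\<Sum>i\<in>I. a i * x i) = 0})
    = int (card (UNIV :: 'a set) - 1) ^ card {i \<in> I. a i = 0} * psi T (card {i \<in> I. a i \<noteq> 0})"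
proof -
  let ?J = "{i \<in> I. a i = 0}" and ?K = "{i \<in> I. a i \<noteq> 0}"
  have I: "?J \<union> ?K = I" by auto
  have disj: "finite ?J" "finite ?K" "?J \<inter> ?K = {}" using assms by auto
  have "card {x \<in> ?J \<union> ?K \<rightarrow>\<^sub>E - {0}. (\<Sum>i\<in>?J \<union> ?K. a i * x i) = 0}
    = (\<Sum>f \<in> ?J \<rightarrow>\<^sub>E - {0}. card {g \<in> ?K \<rightarrow>\<^sub>E - {0}. (\<Sum>i\<in>?J. a i * f i) + (\<Sum>i\<in>?K. a i * g i) = 0})"
    unfolding card_PiE_Un[OF disj finite] sum_if_disjoint[OF disj, where F = "\<lambda>i v. a i * v"] ..
  also have "\<dots> = card (?J \<rightarrow>\<^sub>E - {0 :: 'a}) * card {g \<in> ?K \<rightarrow>\<^sub>E - {0}. (\<Sum>i\<in>?K. a i * g i) = 0}"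
    by simp
  finally show ?thesis
    using card_nonzero_solutions_psi_phi[OF disj(2), of a 0 T] disj
    unfolding I by (simp add: card_PiE card_field_minus_zero)
qed

lemma card_sum_prod_zero_all:
  fixes T :: "'a::{finite,field} itself"
  shows "int (card {y \<in> {..<h} \<rightarrow>\<^sub>E UNIV. (\<Sum>i<h. y i) * (\<Prod>i<h. y i :: 'a) = 0})
    = int (card (UNIV :: 'a set)) ^ h - int (card (UNIV :: 'a set) - 1) ^ h + psi T h"
  using card_sum_prod_zero[of "{..<h}" "\<lambda>_ :: nat \<Rightarrow> 'a. True"]
    card_nonzero_solutions_psi_phi[of "{..<h}" "\<lambda>_. 1" 0 T]
  by (simp add: card_PiE card_field_minus_zero)

section \<open>Weights of codewords and the length of the code\<close>

text \<open>Complementary counting. The zero vector is absent from \<open>D1\<close> but is counted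
  among the common zeros; hence the 1 on the right.\<close>

lemma weight_codeword:
  fixes a :: "nat \<Rightarrow> 'a::{finite,field}"
  assumes "1 \<le> h"
  shows "weight (D1 h k) (codeword k (D1 h k) a)
      + card {x \<in> vecs k. (\<Sum>i<k. a i * x i) = 0 \<and> (\<Sum>i<h. x i) * (\<Prod>i<h. x i) = 0}
    = card (D1 h k :: (nat \<Rightarrow> 'a) set) + 1"
proof -
  let ?D = "D1 h k :: (nat \<Rightarrow> 'a) set"
  let ?K = "{P \<in> ?D. (\<Sum>i<k. a i * P i) = 0}" and ?W = "{P \<in> ?D. (\<Sum>i<k. a i * P i) \<noteq> 0}"
  have fin: "finite ?D"
    by (rule finite_subset[OF _ finite_vecs[of k]]) (auto simp: D1_def)
  have "{P \<in> ?D. codeword k ?D a P \<noteq> 0} = ?W"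
    by (auto simp: codeword_def)
  then have W: "weight ?D (codeword k ?D a) = card ?W"
    by (simp add: weight_def)
  have "{x \<in> vecs k. (\<Sum>i<k. a i * x i) = 0 \<and> (\<Sum>i<h. x i) * (\<Prod>i<h. x i) = 0} = insert (\<lambda>_. 0) ?K"
    using assms by (auto simp: D1_def vecs_def)
  moreover have "(\<lambda>_. 0) \<notin> ?K" "finite ?K"
    using fin by (simp add: D1_def, elim rev_finite_subset) auto
  ultimately have K: "card {x \<in> vecs k. (\<Sum>i<k. a i * x i) = 0 \<and> (\<Sum>i<h. x i) * (\<Prod>i<h. x i) = 0} = card ?K + 1"
    by simp
  have "?D = ?W \<union> ?K" by auto
  then have "card ?D = card ?W + card ?K"
    using fin by (subst card_Un_disjoint[symmetric]) auto
  then show ?thesis using W K by simp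
qed

lemma sum_prod_glued:
  fixes h k :: nat
  assumes "h \<le> k"
  shows "(\<Sum>i<h. if i < h then f i else g i) = (\<Sum>i<h. f i :: 'a::comm_semiring_1)"
    "(\<Prod>i<h. if i < h then f i else g i) = (\<Prod>i<h. f i)"
    "(\<Sum>i<k. a i * (if i < h then f i else if i < k then g i else 0))
      = (\<Sum>i<h. a i * f i) + (\<Sum>i\<in>{h..<k}. a i * g i)"
proof -
  have I: "{..<k} = {..<h} \<union> {h..<k}" using assms by auto
  show "(\<Sum>i<k. a i * (if i < h then f i else if i < k then g i else 0))
      = (\<Sum>i<h. a i * f i) + (\<Sum>i\<in>{h..<k}. a i * g i)"
    unfolding I by (subst sum.union_disjoint) auto
qed auto

lemma card_D1:
  fixes T :: "'a::{finite,field} itself"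
  assumes "1 \<le> h" "h \<le> k"
  shows "int (card (D1 h k :: (nat \<Rightarrow> 'a) set)) + 1 = int (card (UNIV :: 'a set)) ^ (k - h)
    * (int (card (UNIV :: 'a set)) ^ h - int (card (UNIV :: 'a set) - 1) ^ h + psi T h)"
proof -
  \<comment> \<open>The zero form has weight 0, and its common zeros are all of \<open>D1\<close>
    together with the zero vector, so the length falls out of the weight formula.\<close>
  have "weight (D1 h k) (codeword k (D1 h k) (\<lambda>_. 0 :: 'a)) = 0"
    by (simp add: weight_def codeword_def)
  then have "card (D1 h k :: (nat \<Rightarrow> 'a) set) + 1
      = card {x \<in> vecs k. (\<Sum>i<h. x i) * (\<Prod>i<h. x i :: 'a) = 0}"
    using weight_codeword[OF assms(1), of k "\<lambda>_. 0 :: 'a"] by simp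
  also have "\<dots> = (\<Sum>f \<in> {..<h} \<rightarrow>\<^sub>E UNIV.
      if (\<Sum>i<h. f i) * (\<Prod>i<h. f i :: 'a) = 0 then card (UNIV :: 'a set) ^ (k - h) else 0)"
    unfolding card_vecs_split[OF assms(2)] sum_prod_glued(1,2)[OF assms(2)]
    by (intro sum.cong) (auto simp: card_PiE)
  also have "\<dots> = card {y \<in> {..<h} \<rightarrow>\<^sub>E UNIV. (\<Sum>i<h. y i) * (\<Prod>i<h. y i :: 'a) = 0}
      * card (UNIV :: 'a set) ^ (k - h)"
    by (subst sum.If_cases) (auto simp: finite_PiE Int_def)
  finally have "int (card (D1 h k :: (nat \<Rightarrow> 'a) set) + 1)
    = int (card {y \<in> {..<h} \<rightarrow>\<^sub>E UNIV. (\<Sum>i<h. y i) * (\<Prod>i<h. y i :: 'a) = 0})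
      * int (card (UNIV :: 'a set)) ^ (k - h)" by simp
  then show ?thesis
    unfolding card_sum_prod_zero_all[where T = T] by (simp add: mult.commute)
qed

lemma weight_codeword_outside:
  fixes a :: "nat \<Rightarrow> 'a::{finite,field}" and T :: "'a itself"
  assumes "1 \<le> h" "h \<le> j" "j < k" "a j \<noteq> 0"
  shows "int (weight (D1 h k) (codeword k (D1 h k) a))
    = int (card (D1 h k :: (nat \<Rightarrow> 'a) set)) + 1 - int (card (UNIV :: 'a set)) ^ (k - h - 1)
      * (int (card (UNIV :: 'a set)) ^ h - int (card (UNIV :: 'a set) - 1) ^ h + psi T h)"
proof -
  have hk: "h \<le> k" using assms by simp
  \<comment> \<open>Coordinate \<open>j\<close> lies beyond the first h, so the tail can cancel any
    contribution \<open>s\<close> of the first h coordinates, always in the same number of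
    ways.\<close>
  have solutions: "card {g \<in> {h..<k} \<rightarrow>\<^sub>E UNIV. s + (\<Sum>i\<in>{h..<k}. a i * g i) = 0 \<and> R}
      = (if R then card (UNIV :: 'a set) ^ (k - h - 1) else 0)" for s R
    using card_linear_solutions[of "{h..<k}" j a "- s"] assms by (simp add: add_eq_0_iff)
  have "card {x \<in> vecs k. (\<Sum>i<k. a i * x i) = 0 \<and> (\<Sum>i<h. x i) * (\<Prod>i<h. x i) = 0}
    = (\<Sum>f \<in> {..<h} \<rightarrow>\<^sub>E UNIV.
        if (\<Sum>i<h. f i) * (\<Prod>i<h. f i :: 'a) = 0 then card (UNIV :: 'a set) ^ (k - h - 1) else 0)"
    unfolding card_vecs_split[OF hk] sum_prod_glued[OF hk] solutions ..
  also have "\<dots> = card {y \<in> {..<h} \<rightarrow>\<^sub>E UNIV. (\<Sum>i<h. y i) * (\<Prod>i<h. y i :: 'a) = 0}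
      * card (UNIV :: 'a set) ^ (k - h - 1)"
    by (subst sum.If_cases) (auto simp: finite_PiE Int_def)
  finally have "int (card {x \<in> vecs k. (\<Sum>i<k. a i * x i) = 0 \<and> (\<Sum>i<h. x i) * (\<Prod>i<h. x i) = 0})
    = int (card {y \<in> {..<h} \<rightarrow>\<^sub>E UNIV. (\<Sum>i<h. y i) * (\<Prod>i<h. y i :: 'a) = 0})
      * int (card (UNIV :: 'a set)) ^ (k - h - 1)" by simp
  then show ?thesis
    using arg_cong[OF weight_codeword[OF assms(1), of k a], of int]
    unfolding card_sum_prod_zero_all[where T = T] by (simp add: mult.commute)
qed

text \<open>The last k - h coordinates are free, which gives the factor q^(k-h). The three terms of
  \<open>card_sum_prod_zero\<close> become q^(h-1), the count with all coordinates nonzero, and the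
  joint solutions that A counts.\<close>

lemma weight_codeword_inside:
  fixes a :: "nat \<Rightarrow> 'a::{finite,field}" and T :: "'a itself"
  assumes "1 \<le> h" "h \<le> k" "\<forall>i\<ge>h. a i = 0" "j < h" "a j \<noteq> 0"
  shows "int (weight (D1 h k) (codeword k (D1 h k) a))
    = int (card (D1 h k :: (nat \<Rightarrow> 'a) set)) + 1 - int (card (UNIV :: 'a set)) ^ (k - 1)
      + int (card (UNIV :: 'a set)) ^ (k - h)
        * (int (card (UNIV :: 'a set) - 1) ^ card {i. i < h \<and> a i = 0} * psi T (card {i. i < h \<and> a i \<noteq> 0}))
      - int (card (UNIV :: 'a set)) ^ (k - h)
        * int (card {x \<in> {..<h} \<rightarrow>\<^sub>E - {0}. (\<Sum>i<h. x i) = 0 \<and> (\<Sum>i<h. a i * x i) = 0})"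
proof -
  let ?q = "card (UNIV :: 'a set)"
  have tail: "(\<Sum>i\<in>{h..<k}. a i * g i) = 0" for g
    using assms(3) by (intro sum.neutral) auto
  have const: "card {g \<in> {h..<k} \<rightarrow>\<^sub>E (UNIV :: 'a set). R} = (if R then ?q ^ (k - h) else 0)" for R
    by (simp add: card_PiE)
  have "card {x \<in> vecs k. (\<Sum>i<k. a i * x i) = 0 \<and> (\<Sum>i<h. x i) * (\<Prod>i<h. x i) = 0}
    = (\<Sum>f \<in> {..<h} \<rightarrow>\<^sub>E UNIV.
        if (\<Sum>i<h. a i * f i) = 0 \<and> (\<Sum>i<h. f i) * (\<Prod>i<h. f i :: 'a) = 0 then ?q ^ (k - h) else 0)"
    unfolding card_vecs_split[OF assms(2)] sum_prod_glued[OF assms(2)] tail add_0_right const ..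
  also have "\<dots> = card {y \<in> {..<h} \<rightarrow>\<^sub>E UNIV. (\<Sum>i<h. a i * y i) = 0 \<and> (\<Sum>i<h. y i) * (\<Prod>i<h. y i :: 'a) = 0}
      * ?q ^ (k - h)"
    by (subst sum.If_cases) (auto simp: finite_PiE Int_def)
  finally have N: "int (card {x \<in> vecs k. (\<Sum>i<k. a i * x i) = 0 \<and> (\<Sum>i<h. x i) * (\<Prod>i<h. x i) = 0})
    = int ?q ^ (k - h) * int (card {y \<in> {..<h} \<rightarrow>\<^sub>E UNIV.
        (\<Sum>i<h. a i * y i) = 0 \<and> (\<Sum>i<h. y i) * (\<Prod>i<h. y i :: 'a) = 0})" by simp
  have solutions: "card {y \<in> {..<h} \<rightarrow>\<^sub>E UNIV. (\<Sum>i<h. a i * y i) = 0} = ?q ^ (h - 1)"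
    using card_linear_solutions[of "{..<h}" j a 0] assms by simp
  have sets: "{i \<in> {..<h}. P i} = {i. i < h \<and> P i}" for P by auto
  have pow: "int ?q ^ (k - h) * int ?q ^ (h - 1) = int ?q ^ (k - 1)"
    using assms(1,2) by (simp flip: power_add)
  have arith: "d - (x - y + z) = d - x + y - z" for d x y z :: int
    by simp
  have "int (weight (D1 h k) (codeword k (D1 h k) a))
      = int (card (D1 h k :: (nat \<Rightarrow> 'a) set)) + 1 - int (card {x \<in> vecs k.
          (\<Sum>i<k. a i * x i) = 0 \<and> (\<Sum>i<h. x i) * (\<Prod>i<h. x i) = 0})"
    using weight_codeword[OF assms(1), of k a] by linarith
  then show ?thesis
    unfolding N card_sum_prod_zero[OF finite_lessThan] solutions
      card_linear_solutions_nonzero[OF finite_lessThan, where T = T] sets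
      of_nat_power distrib_left right_diff_distrib pow arith .
qed

section \<open>From value partitions to the numbers A\<close>

text \<open>\<open>A\<close> takes an ordered list, whereas a value partition is a multiset. This
  lifts an ordering of the block sizes to an ordering of the values themselves, also when several
  values have equal block sizes.\<close>

lemma image_mset_eq_mset_obtain:
  assumes "image_mset f M = mset ys"
  obtains xs where "mset xs = M" "map f xs = ys"
  using assms
proof (induction ys arbitrary: M thesis)
  case Nil
  then show ?case by simp
next
  case (Cons y ys)
  then obtain M' x where M: "M = add_mset x M'" "f x = y" "image_mset f M' = mset ys"
    using msed_map_invR[of f M y "mset ys"] by auto
  obtain xs where "mset xs = M'" "map f xs = ys" using Cons.IH M(3) by blast
  then show ?case using Cons.prems(1)[of "x # xs"] M by simp
qed

lemma sum_value_partition: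
  "sum_mset (value_partition h a) = card {i. i < h \<and> a i \<noteq> (0 :: 'a::zero)}"
proof -
  let ?V = "{a i | i. i < h \<and> a i \<noteq> 0}"
  have fin: "finite ?V" by (rule finite_subset[of _ "a ` {..<h}"]) auto
  have "sum_mset (value_partition h a) = (\<Sum>v\<in>?V. card {i. i < h \<and> a i = v})"
    by (simp add: value_partition_def sum_unfold_sum_mset)
  also have "\<dots> = card (\<Union>v\<in>?V. {i. i < h \<and> a i = v})"
    using fin by (subst card_UN_disjoint) auto
  also have "(\<Union>v\<in>?V. {i. i < h \<and> a i = v}) = {i. i < h \<and> a i \<noteq> 0}" by auto
  finally show ?thesis .
qed

text \<open>The block of zeros comes last in \<open>A_ext\<close>, hence first in the reversed list:
  the values are enumerated as 0 followed by the nonzero ones in an order that produces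
  \<open>rev rs\<close>.\<close>

lemma A_ext_eq_card_joint_solutions:
  fixes a :: "nat \<Rightarrow> 'a::{finite,field}" and T :: "'a itself"
  assumes "value_partition h a = mset rs" "rs \<noteq> []"
  shows "A_ext T rs (card {i. i < h \<and> a i = 0})
    = int (card {x \<in> {..<h} \<rightarrow>\<^sub>E - {0}. (\<Sum>i<h. x i) = 0 \<and> (\<Sum>i<h. a i * x i) = 0})"
proof -
  let ?f = "\<lambda>v. card {i \<in> {..<h}. a i = v}" and ?V = "{a i | i. i < h \<and> a i \<noteq> 0}"
  have fin: "finite ?V" by (rule finite_subset[of _ "a ` {..<h}"]) auto
  have "image_mset ?f (mset_set ?V) = mset (rev rs)"
    using assms(1) by (simp add: value_partition_def)
  then obtain vs where vs: "mset vs = mset_set ?V" "map ?f vs = rev rs"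
    by (rule image_mset_eq_mset_obtain)
  have set: "set vs = ?V" using arg_cong[OF vs(1), of set_mset] fin by simp
  have dist: "distinct vs" by (rule mset_eq_mset_set_imp_distinct[OF fin vs(1)[symmetric]])
  have "set (0 # vs) = insert 0 ?V" by (simp add: set)
  then have "a ` {..<h} \<subseteq> set (0 # vs)" by auto
  moreover have "0 \<notin> set vs" unfolding set by auto
  ultimately have *: "Arev T (map ?f (0 # vs))
      = int (card {x \<in> {..<h} \<rightarrow>\<^sub>E - {0}. (\<Sum>i<h. x i) = 0 \<and> (\<Sum>i<h. a i * x i) = 0})"
    using dist by (intro Arev_eq_card_joint_solutions) auto
  obtain r rs' where rev: "rev rs = r # rs'" using assms(2) by (cases "rev rs") auto
  \<comment> \<open>an empty block leaves \<open>Arev\<close> unchanged, so the case distinction in \<open>A_ext\<close> disappears\<close>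
  have "phi T 0 = 0" by (simp add: phi_def)
  then have "Arev T (0 # rev rs) = Arev T (rev rs)" by (simp add: rev)
  then have "A_ext T rs t = Arev T (t # rev rs)" for t by (simp add: A_ext_def A_def)
  then show ?thesis using * vs(2) by simp
qed

section \<open>Linear forms with a given value partition\<close>

text \<open>Reading a function along a fixed enumeration of \<open>I\<close> turns it into an
  arrangement of \<open>M\<close>. This is applied both to fibre sizes, as functions on the nonzero
  field elements, and to forms, as functions on coordinates.\<close>

lemma card_functions_image_mset:
  assumes "finite I" "size M = card I"
  shows "card {f \<in> I \<rightarrow>\<^sub>E UNIV. image_mset f (mset_set I) = M} * (\<Prod>x\<in>set_mset M. fact (count M x))
    = fact (card I)"
proof -
  obtain xs where xs: "set xs = I" "distinct xs"
    using finite_distinct_list[OF assms(1)] by blast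
  have mset_map: "mset (map f xs) = image_mset f (mset_set I)" for f :: "'a \<Rightarrow> 'b"
    using mset_set_set[OF xs(2)] by (simp add: xs(1))
  have "bij_betw (\<lambda>f. map f xs) {f \<in> I \<rightarrow>\<^sub>E UNIV. image_mset f (mset_set I) = M} (permutations_of_multiset M)"
    unfolding bij_betw_def
  proof
    show "inj_on (\<lambda>f. map f xs) {f \<in> I \<rightarrow>\<^sub>E UNIV. image_mset f (mset_set I) = M}"
      using xs(1) by (intro inj_onI PiE_ext[of _ I "\<lambda>_. UNIV"]) auto
    show "(\<lambda>f. map f xs) ` {f \<in> I \<rightarrow>\<^sub>E UNIV. image_mset f (mset_set I) = M} = permutations_of_multiset M"
    proof (intro equalityI subsetI)
      fix ys assume "ys \<in> (\<lambda>f. map f xs) ` {f \<in> I \<rightarrow>\<^sub>E UNIV. image_mset f (mset_set I) = M}"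
      then show "ys \<in> permutations_of_multiset M"
        using mset_map by (auto simp: permutations_of_multiset_def)
    next
      fix ys assume "ys \<in> permutations_of_multiset M"
      then have ys: "mset ys = M" by (rule permutations_of_multisetD)
      then have len: "length xs = length ys"
        using assms(2) xs by (metis size_mset distinct_card)
      define f where "f = restrict (\<lambda>i. the (map_of (zip xs ys) i)) I"
      have map: "map f xs = ys"
      proof (rule nth_equalityI)
        fix i assume i: "i < length (map f xs)"
        then have "xs ! i \<in> I" using xs(1) by auto
        then show "map f xs ! i = ys ! i"
          using i len xs(2) by (simp add: f_def map_of_zip_nth)
      qed (simp add: len)
      have "f \<in> {f \<in> I \<rightarrow>\<^sub>E UNIV. image_mset f (mset_set I) = M}"
        using mset_map[of f] by (simp add: map ys) (simp add: f_def)
      then show "ys \<in> (\<lambda>f. map f xs) ` {f \<in> I \<rightarrow>\<^sub>E UNIV. image_mset f (mset_set I) = M}"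
        using map by blast
    qed
  qed
  from bij_betw_same_card[OF this] show ?thesis
    using card_permutations_of_multiset_aux[of M] by (simp add: assms(2))
qed

lemma prod_fact_count_superset:
  assumes "finite S" "set_mset M \<subseteq> S"
  shows "(\<Prod>x\<in>set_mset M. fact (count M x)) = (\<Prod>x\<in>S. fact (count M x) :: nat)"
  using assms by (intro prod.mono_neutral_left) (auto simp: not_in_iff)

text \<open>A value partition lists only values that occur. Padding it with a zero for each missing
  value gives a multiset of fixed size, to which the count of functions with prescribed image
  multiset applies.\<close>

lemma filter_pos_eq_iff:
  fixes M :: "nat multiset"
  assumes "\<forall>r\<in>#R. 0 < r" "size M = n" "size R \<le> n"
  shows "filter_mset (\<lambda>r. 0 < r) M = R \<longleftrightarrow> M = R + replicate_mset (n - size R) 0"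
proof
  assume R: "filter_mset (\<lambda>r. 0 < r) M = R"
  have "M = R + filter_mset (\<lambda>r. r = 0) M"
    by (rule multiset_partition[of M "\<lambda>r. 0 < r", unfolded R not_gr_zero])
  also have "filter_mset (\<lambda>r. r = 0) M = replicate_mset (count M 0) 0"
    by (rule filter_eq_replicate_mset)
  finally have M: "M = R + replicate_mset (count M 0) 0" .
  have c: "count M 0 = n - size R"
    using arg_cong[OF M, of size, unfolded size_union size_replicate_mset assms(2)] by linarith
  show "M = R + replicate_mset (n - size R) 0"
    by (rule M[unfolded c])
next
  assume M: "M = R + replicate_mset (n - size R) 0"
  have "count R 0 = 0"
    using assms(1) by (auto simp: count_eq_zero_iff)
  then show "filter_mset (\<lambda>r. 0 < r) M = R"
    unfolding M by (intro multiset_eqI) simp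
qed

text \<open>The multiplicity of \<open>z\<close> is forced by the total size. Used at 0, where fibre
  sizes carry no information.\<close>

lemma multiset_eq_off_point:
  assumes "size K = size L" "\<And>x. x \<noteq> z \<Longrightarrow> count K x = count L x"
  shows "K = L"
proof -
  have f: "filter_mset (\<lambda>x. x \<noteq> z) K = filter_mset (\<lambda>x. x \<noteq> z) L"
    using assms(2) by (intro multiset_eqI) simp
  have part: "filter_mset (\<lambda>x. x \<noteq> z) M + replicate_mset (count M z) z = M" for M
    by (rule multiset_partition[of M "\<lambda>x. x \<noteq> z", unfolded not_not filter_eq_replicate_mset, symmetric])
  have "size (filter_mset (\<lambda>x. x \<noteq> z) M) + count M z = size M" for M
    using arg_cong[OF part[of M], of size] by (simp only: size_union size_replicate_mset)
  from this[of K] this[of L] have "count K z = count L z"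
    unfolding f assms(1) by linarith
  with part[of K] part[of L] show ?thesis unfolding f by metis
qed

text \<open>The intermediate object of the double count. Unattained values are kept with size 0, so
  that the domain does not depend on \<open>a\<close>; the value 0 is left out because its fibre is
  whatever remains of the h coordinates.\<close>

definition fiber_sizes :: "nat \<Rightarrow> (nat \<Rightarrow> 'a::zero) \<Rightarrow> 'a \<Rightarrow> nat" where
  "fiber_sizes h a = restrict (\<lambda>v. card {i. i < h \<and> a i = v}) (- {0})"

lemma value_partition_fiber_sizes:
  fixes a :: "nat \<Rightarrow> 'a::{finite,zero}"
  shows "value_partition h a = filter_mset (\<lambda>r. 0 < r) (image_mset (fiber_sizes h a) (mset_set (- {0})))"
proof -
  have "{v \<in> - {0}. 0 < card {i. i < h \<and> a i = v}} = {a i | i. i < h \<and> a i \<noteq> 0}"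
    by (auto simp: card_gt_0_iff)
  moreover have "image_mset (fiber_sizes h a) (mset_set (- {0}))
      = image_mset (\<lambda>v. card {i. i < h \<and> a i = v}) (mset_set (- {0}))"
    by (intro image_mset_cong) (simp add: fiber_sizes_def)
  ultimately show ?thesis
    by (simp add: value_partition_def filter_mset_image_mset filter_mset_mset_set)
qed

lemma size_value_partition:
  fixes a :: "nat \<Rightarrow> 'a::{finite,zero}"
  shows "size (value_partition h a) \<le> card (- {0 :: 'a})"
  unfolding value_partition_fiber_sizes
  by (rule order_trans[OF size_filter_mset_lesseq]) simp

text \<open>Fibre sizes on the nonzero values fix the whole multiset of values of \<open>a\<close>,
  since 0 takes the remaining coordinates. It remains to count the arrangements of that multiset
  \<open>M\<close>.\<close>

lemma card_fiber_sizes_eq: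
  fixes n :: "'a::{finite,zero} \<Rightarrow> nat"
  assumes "n \<in> - {0} \<rightarrow>\<^sub>E UNIV" "(\<Sum>v\<in>- {0}. n v) \<le> h"
  shows "card {a \<in> {..<h} \<rightarrow>\<^sub>E UNIV. fiber_sizes h a = n}
      * (fact (h - (\<Sum>v\<in>- {0}. n v)) * (\<Prod>v\<in>- {0}. fact (n v))) = fact h"
proof -
  define m where "m v = (if v = 0 then h - (\<Sum>v\<in>- {0}. n v) else n v)" for v
  define M where "M = (\<Sum>v\<in>UNIV. replicate_mset (m v) v)"
  have UNIV: "UNIV = insert 0 (- {0 :: 'a})" by auto
  have count_M: "count M v = m v" for v
    by (simp add: M_def count_sum)
  have "size M = (\<Sum>v\<in>UNIV. m v)" by (simp add: M_def size_multiset_sum)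
  also have "\<dots> = (h - (\<Sum>v\<in>- {0}. n v)) + (\<Sum>v\<in>- {0}. n v)"
    unfolding UNIV by (subst sum.insert) (auto simp: m_def)
  finally have size_M: "size M = h" using assms(2) by simp
  have "(\<Prod>x\<in>set_mset M. fact (count M x)) = (\<Prod>v\<in>UNIV. fact (m v) :: nat)"
    using prod_fact_count_superset[of UNIV M] by (simp add: count_M)
  also have "\<dots> = fact (h - (\<Sum>v\<in>- {0}. n v)) * (\<Prod>v\<in>- {0}. fact (n v))"
    unfolding UNIV by (subst prod.insert) (auto simp: m_def)
  finally have prod_M: "(\<Prod>x\<in>set_mset M. fact (count M x) :: nat)
      = fact (h - (\<Sum>v\<in>- {0}. n v)) * (\<Prod>v\<in>- {0}. fact (n v))" .
  have count_image: "count (image_mset a (mset_set {..<h})) v = card {i. i < h \<and> a i = v}"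
    for a :: "nat \<Rightarrow> 'a" and v
    by (simp add: count_image_mset' conj_commute eq_commute[of v])
  have "fiber_sizes h a = n \<longleftrightarrow> image_mset a (mset_set {..<h}) = M" for a
  proof
    assume n: "fiber_sizes h a = n"
    show "image_mset a (mset_set {..<h}) = M"
    proof (rule multiset_eq_off_point[where z = 0])
      show "count (image_mset a (mset_set {..<h})) v = count M v" if "v \<noteq> 0" for v
        unfolding count_image count_M using that by (simp add: m_def n[symmetric] fiber_sizes_def)
    qed (simp add: size_M)
  next
    assume M: "image_mset a (mset_set {..<h}) = M"
    show "fiber_sizes h a = n"
    proof
      fix v
      show "fiber_sizes h a v = n v"
        using assms(1) count_image[of a v, unfolded M count_M]
        by (cases "v = 0") (auto simp: fiber_sizes_def m_def PiE_def extensional_def)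
    qed
  qed
  then show ?thesis
    using card_functions_image_mset[of "{..<h}" M] by (simp add: size_M prod_M)
qed

section \<open>The number of forms with a given value partition\<close>

text \<open>Makes the \<open>div\<close> in \<open>multinomial\<close> exact.\<close>

lemma prod_fact_dvd_fact_sum: "prod_list (map fact rs) dvd (fact (sum_list rs) :: nat)"
proof (induction rs)
  case (Cons r rs)
  have "fact r * prod_list (map fact rs) dvd (fact r * fact (sum_list rs) :: nat)"
    using Cons by (rule mult_dvd_mono[OF dvd_refl])
  also have "\<dots> dvd fact (r + sum_list rs)" by (rule fact_fact_dvd_fact)
  finally show ?case by simp
qed simp

lemma multinomial_mult: "multinomial (sum_list rs) rs * prod_list (map fact rs) = fact (sum_list rs)"
  by (simp add: multinomial_def prod_fact_dvd_fact_sum)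

lemma sum_tuple_type: "sum_list (tuple_type rs) = length rs"
  using size_multiset_overloaded_eq[of "mset rs"]
  by (simp add: tuple_type_def sum_list_distinct_conv_sum_set)

text \<open>With p = q - 1 there are p! / ((p-l)! i_1! ... i_j!) ways to distribute the parts over
  the nonzero values, the p - l zeros marking unattained values, and for each of them h! / ((h-s)!
  r_1! ... r_l!) forms.\<close>

lemma card_value_partition_mult:
  assumes "\<forall>r\<in>set rs. 0 < r" "sum_list rs \<le> h" "length rs \<le> card (UNIV :: 'a::{finite,field} set) - 1"
  shows "card {a \<in> {..<h} \<rightarrow>\<^sub>E (UNIV :: 'a set). value_partition h a = mset rs}
      * (fact (h - sum_list rs) * prod_list (map fact rs))
      * (fact (card (UNIV :: 'a set) - 1 - length rs) * prod_list (map fact (tuple_type rs)))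
    = fact h * fact (card (UNIV :: 'a set) - 1)"
proof -
  let ?V = "{a \<in> {..<h} \<rightarrow>\<^sub>E (UNIV :: 'a set). value_partition h a = mset rs}"
  define p where "p = card (UNIV :: 'a set) - 1"
  define R where "R = mset rs + replicate_mset (p - length rs) 0"
  define N where "N = {n \<in> - {0 :: 'a} \<rightarrow>\<^sub>E UNIV. image_mset n (mset_set (- {0})) = R}"
  have p: "card (- {0 :: 'a}) = p" by (simp add: p_def card_field_minus_zero)
  have le: "length rs \<le> p" using assms(3) by (simp add: p_def)
  have size_R: "size R = card (- {0 :: 'a})" using le by (simp add: R_def p)
  have V_iff: "value_partition h a = mset rs \<longleftrightarrow> fiber_sizes h a \<in> N" for a :: "nat \<Rightarrow> 'a"
    unfolding value_partition_fiber_sizes using assms(1) le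
    by (subst filter_pos_eq_iff[where n = p]) (auto simp: p N_def R_def fiber_sizes_def)
  have "set_mset R \<subseteq> insert 0 (set rs)" by (auto simp: R_def)
  then have "(\<Prod>x\<in>set_mset R. fact (count R x) :: nat) = (\<Prod>x\<in>insert 0 (set rs). fact (count R x))"
    by (intro prod_fact_count_superset) auto
  also have "\<dots> = fact (count R 0) * (\<Prod>x\<in>set rs. fact (count R x))"
    using assms(1) by (subst prod.insert) auto
  also have "count R 0 = p - length rs"
    using assms(1) by (auto simp: R_def count_eq_zero_iff)
  also have "(\<Prod>x\<in>set rs. fact (count R x) :: nat) = (\<Prod>x\<in>set rs. fact (count (mset rs) x))"
    using assms(1) by (intro prod.cong) (auto simp: R_def)
  also have "\<dots> = prod_list (map fact (tuple_type rs))"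
    using prod.distinct_set_conv_list[of "remdups rs" "\<lambda>x. fact (count (mset rs) x) :: nat"]
    by (simp add: tuple_type_def o_def)
  finally have card_N: "card N * (fact (p - length rs) * prod_list (map fact (tuple_type rs))) = fact p"
    using card_functions_image_mset[OF finite size_R] by (simp add: N_def p)
  \<comment> \<open>\<open>N\<close> consists of functions into the naturals, so finiteness is not
    automatic. An infinite set would have \<open>card\<close> 0, which the factorial in
    \<open>card_N\<close> excludes.\<close>
  have fin_N: "finite N"
  proof (rule ccontr)
    assume "infinite N"
    then show False using card_N by simp
  qed
  have fiber: "card {a \<in> ?V. fiber_sizes h a = n} * (fact (h - sum_list rs) * prod_list (map fact rs)) = fact h"
    if "n \<in> N" for n
  proof -
    have n: "n \<in> - {0} \<rightarrow>\<^sub>E UNIV" "image_mset n (mset_set (- {0})) = R"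
      using that by (auto simp: N_def)
    \<comment> \<open>The sum and the product of factorials over the values depend only on
      \<open>R\<close>, where the padding zeros contribute 0 and 0! = 1.\<close>
    have "(\<Sum>v\<in>- {0}. n v) = sum_mset R"
      by (simp add: sum_unfold_sum_mset n(2))
    then have sum: "(\<Sum>v\<in>- {0}. n v) = sum_list rs" by (simp add: R_def sum_mset_sum_list)
    have "(\<Prod>v\<in>- {0}. fact (n v)) = prod_mset (image_mset fact R)"
      by (simp add: prod_unfold_prod_mset n(2)[symmetric] image_mset.compositionality o_def)
    then have prod: "(\<Prod>v\<in>- {0}. fact (n v) :: nat) = prod_list (map fact rs)"
      by (simp add: R_def flip: mset_map prod_mset_prod_list)
    have "{a \<in> ?V. fiber_sizes h a = n} = {a \<in> {..<h} \<rightarrow>\<^sub>E UNIV. fiber_sizes h a = n}"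
      using that V_iff by auto
    then show ?thesis
      using card_fiber_sizes_eq[OF n(1), of h] assms(2) by (simp add: sum prod)
  qed
  have fin_V: "finite ?V"
    by (rule finite_subset[of _ "{..<h} \<rightarrow>\<^sub>E UNIV"]) (auto simp: finite_PiE)
  have "fiber_sizes h ` ?V \<subseteq> N" using V_iff by blast
  from sum.group[OF fin_V fin_N this, of "\<lambda>_. 1 :: nat"]
  have "card ?V = (\<Sum>n\<in>N. card {a \<in> ?V. fiber_sizes h a = n})"
    by (simp only: card_eq_sum)
  then have "card ?V * (fact (h - sum_list rs) * prod_list (map fact rs))
      = (\<Sum>n\<in>N. card {a \<in> ?V. fiber_sizes h a = n} * (fact (h - sum_list rs) * prod_list (map fact rs)))"
    by (simp only: sum_distrib_right)
  also have "\<dots> = (\<Sum>n\<in>N. fact h)"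
    by (rule sum.cong[OF refl fiber])
  finally have V: "card ?V * (fact (h - sum_list rs) * prod_list (map fact rs)) = card N * fact h"
    by simp
  have "card ?V * (fact (h - sum_list rs) * prod_list (map fact rs))
      * (fact (p - length rs) * prod_list (map fact (tuple_type rs)))
    = fact h * (card N * (fact (p - length rs) * prod_list (map fact (tuple_type rs))))"
    unfolding V by (simp only: mult_ac)
  then show ?thesis
    unfolding card_N unfolding p_def .
qed

lemma value_partition_exists:
  assumes "\<forall>r\<in>set rs. 0 < r" "sum_list rs \<le> h" "length rs \<le> card (UNIV :: 'a::{finite,field} set) - 1"
  obtains a :: "nat \<Rightarrow> 'a::{finite,field}" where "a \<in> {..<h} \<rightarrow>\<^sub>E UNIV" "value_partition h a = mset rs"
proof -
  have "{a \<in> {..<h} \<rightarrow>\<^sub>E (UNIV :: 'a set). value_partition h a = mset rs} \<noteq> {}"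
  proof
    assume "{a \<in> {..<h} \<rightarrow>\<^sub>E (UNIV :: 'a set). value_partition h a = mset rs} = {}"
    \<comment> \<open>The right-hand side is a product of factorials, so the set counted cannot be
      empty.\<close>
    from card_value_partition_mult[OF assms, unfolded this] show False by simp
  qed
  then show ?thesis using that by blast
qed

text \<open>If there are more parts than nonzero field elements, both sides are 0. Otherwise h! and
  (q-1)! are expanded by binomial coefficients, s! and l! by multinomial ones, and the common
  nonzero factor cancels.\<close>

lemma card_value_partition:
  assumes "\<forall>r\<in>set rs. 0 < r" "sum_list rs \<le> h"
  shows "card {a \<in> {..<h} \<rightarrow>\<^sub>E (UNIV :: 'a::{finite,field} set). value_partition h a = mset rs}
    = (h choose sum_list rs) * multinomial (sum_list rs) rs * multinomial (length rs) (tuple_type rs)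
      * ((card (UNIV :: 'a set) - 1) choose length rs)"
proof (cases "length rs \<le> card (UNIV :: 'a set) - 1")
  case True
  define p where "p = card (UNIV :: 'a set) - 1"
  let ?s = "sum_list rs" and ?l = "length rs"
  let ?P = "prod_list (map fact rs) :: nat" and ?Q = "prod_list (map fact (tuple_type rs)) :: nat"
  have "card {a \<in> {..<h} \<rightarrow>\<^sub>E (UNIV :: 'a set). value_partition h a = mset rs}
      * ((fact (h - ?s) * ?P) * (fact (p - ?l) * ?Q)) = fact h * fact p"
    using card_value_partition_mult[OF assms True] by (simp add: p_def mult.assoc)
  also have "\<dots> = (fact ?s * fact (h - ?s) * (h choose ?s)) * (fact ?l * fact (p - ?l) * (p choose ?l))"
    by (simp only: binomial_fact_lemma[OF assms(2)] binomial_fact_lemma[OF True[folded p_def]])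
  also have "\<dots> = (h choose ?s) * multinomial ?s rs * multinomial ?l (tuple_type rs) * (p choose ?l)
      * ((fact (h - ?s) * ?P) * (fact (p - ?l) * ?Q))"
    unfolding multinomial_mult[symmetric] multinomial_mult[of "tuple_type rs", unfolded sum_tuple_type, symmetric]
    by (simp only: mult_ac)
  finally show ?thesis
    by (auto simp: p_def prod_list_zero_iff)
next
  case False
  have "{a \<in> {..<h} \<rightarrow>\<^sub>E (UNIV :: 'a set). value_partition h a = mset rs} = {}"
  proof -
    have "value_partition h a \<noteq> mset rs" for a :: "nat \<Rightarrow> 'a"
      using size_value_partition[of h a] False by (auto simp: card_field_minus_zero)
    then show ?thesis by simp
  qed
  then show ?thesis using False by (simp only: card.empty) (simp add: binomial_eq_0)
qed

section \<open>The weight spectrum\<close>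

lemma vecs_mono: "h \<le> k \<Longrightarrow> vecs h \<subseteq> vecs k"
  by (auto simp: vecs_def)

text \<open>Evaluation at a unit vector recovers a coefficient. Unit vectors belong to
  \<open>D1\<close> because for h >= 2 at least one of their first h coordinates is 0.\<close>

lemma inj_on_codeword:
  assumes "2 \<le> h" "h \<le> k"
  shows "inj_on (codeword k (D1 h k :: (nat \<Rightarrow> 'a::field) set)) (vecs k)"
proof (rule inj_onI)
  fix a b :: "nat \<Rightarrow> 'a"
  assume ab: "a \<in> vecs k" "b \<in> vecs k"
    and eq: "codeword k (D1 h k) a = codeword k (D1 h k) b"
  show "a = b"
  proof
    fix i
    show "a i = b i"
    proof (cases "i < k")
      case True
      define e where "e j = (if j = i then 1 else 0 :: 'a)" for j
      obtain j where "j < h" "j \<noteq> i"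
        using assms(1) that[of "if i = 0 then 1 else 0"] by (auto split: if_splits)
      then have "(\<Prod>i<h. e i) = 0"
        by (auto simp: e_def)
      moreover have "e \<noteq> (\<lambda>_. 0)" by (auto simp: e_def fun_eq_iff)
      ultimately have "e \<in> D1 h k"
        using True by (simp add: D1_def vecs_def e_def)
      moreover have "(\<Sum>j<k. c j * e j) = c i" for c
        using True by (simp add: e_def if_distrib[of "\<lambda>x. _ * x"] cong: if_cong)
      ultimately show ?thesis
        using fun_cong[OF eq, of e] by (simp add: codeword_def)
    next
      case False
      then show ?thesis using ab by (simp add: vecs_def)
    qed
  qed
qed

lemma value_partition_cong:
  assumes "\<And>i. i < h \<Longrightarrow> a i = b i"
  shows "value_partition h a = value_partition h b"
proof -
  have "{i. i < h \<and> a i = v} = {i. i < h \<and> b i = v}" for v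
    using assms by auto
  moreover have "{a i | i. i < h \<and> a i \<noteq> 0} = {b i | i. i < h \<and> b i \<noteq> 0}"
    by (intro Collect_cong) (metis assms)
  ultimately show ?thesis by (simp add: value_partition_def)
qed

lemma card_vecs_value_partition:
  fixes R :: "nat multiset"
  shows "card {a \<in> vecs h. value_partition h (a :: nat \<Rightarrow> 'a::{finite,field}) = R}
    = card {a \<in> {..<h} \<rightarrow>\<^sub>E (UNIV :: 'a set). value_partition h a = R}"
proof -
  have vp: "value_partition h (\<lambda>i. if i < h then f i else if i < h then g i else 0) = value_partition h f"
    for f g :: "nat \<Rightarrow> 'a"
    by (rule value_partition_cong) simp
  have "card {a \<in> vecs h. value_partition h (a :: nat \<Rightarrow> 'a) = R}
    = (\<Sum>f \<in> {..<h} \<rightarrow>\<^sub>E UNIV. if value_partition h (f :: nat \<Rightarrow> 'a) = R then 1 else 0)"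
    unfolding card_vecs_split[OF order_refl] vp by (rule sum.cong) auto
  also have "\<dots> = card {a \<in> {..<h} \<rightarrow>\<^sub>E (UNIV :: 'a set). value_partition h a = R}"
    by (subst sum.If_cases) (auto simp: finite_PiE Int_def)
  finally show ?thesis .
qed

lemma weight_codeword_value_partition:
  fixes a :: "nat \<Rightarrow> 'a::{finite,field}" and T :: "'a itself"
  assumes "h \<le> k" "\<forall>i\<ge>h. a i = 0" "value_partition h a = mset rs" "rs \<noteq> []" "1 \<le> sum_list rs"
  shows "int (weight (D1 h k) (codeword k (D1 h k) a))
    = int (card (D1 h k :: (nat \<Rightarrow> 'a) set)) + 1 - int (card (UNIV :: 'a set)) ^ (k - 1)
      + int (card (UNIV :: 'a set)) ^ (k - h)
        * (int (card (UNIV :: 'a set) - 1) ^ (h - sum_list rs) * psi T (sum_list rs))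
      - int (card (UNIV :: 'a set)) ^ (k - h) * A_ext T rs (h - sum_list rs)"
proof -
  have s: "card {i. i < h \<and> a i \<noteq> 0} = sum_list rs"
    using sum_value_partition[of h a] assms(3) by (simp add: sum_mset_sum_list)
  have "{i. i < h \<and> a i \<noteq> 0} \<noteq> {}"
  proof
    assume "{i. i < h \<and> a i \<noteq> 0} = {}"
    from s[unfolded this card.empty] assms(5) show False by linarith
  qed
  then obtain j where j: "j < h" "a j \<noteq> 0" by blast
  have z: "card {i. i < h \<and> a i = 0} = h - sum_list rs"
  proof -
    have "{i. i < h \<and> a i = 0} = {..<h} - {i. i < h \<and> a i \<noteq> 0}" by auto
    then have "card {i. i < h \<and> a i = 0} = card {..<h} - card {i. i < h \<and> a i \<noteq> 0}"
      by (simp only:) (rule card_Diff_subset, auto)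
    then show ?thesis by (simp only: s card_lessThan)
  qed
  have "1 \<le> h" using j by simp
  from weight_codeword_inside[OF this assms(1,2) j, of T] show ?thesis
    unfolding A_ext_eq_card_joint_solutions[OF assms(3,4), of T, symmetric] z s .
qed

text \<open>For h = k the exponent k - h - 1 is -1, hence the integer power of a real; times q it
  equals q^(k-h) in all cases.\<close>

lemma card_D1_closed_form:
  assumes "1 \<le> h" "h \<le> k"
  shows "real (card (D1 h k :: (nat \<Rightarrow> 'a::{finite,field}) set))
    = real (card (UNIV :: 'a set)) powi (int k - int h - 1)
      * real_of_int (int (card (UNIV :: 'a set)) ^ (h + 1) - int (card (UNIV :: 'a set) - 1) ^ (h + 1)
          + (- 1) ^ h * int (card (UNIV :: 'a set) - 1)) - 1"
proof -
  define q where "q = card (UNIV :: 'a set)"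
  \<comment> \<open>\<open>B\<close> is the number of y in F_q^h with (sum y)(prod y) = 0. The
    bracket in the formula for n is q B, and the exponent k - h - 1 compensates the extra q.\<close>
  define B where "B = int q ^ h - (int q - 1) ^ h + psi TYPE('a) h"
  have q0: "real q \<noteq> 0" by (simp add: q_def)
  have psi: "int q * psi TYPE('a) h = (int q - 1) ^ h + (- 1) ^ h * (int q - 1)"
    unfolding q_def by (rule psi_closed_form)
  have "int q ^ (h + 1) - int (q - 1) ^ (h + 1) + (- 1) ^ h * int (q - 1)
      = int q ^ (h + 1) - (int q - 1) ^ (h + 1) + (- 1) ^ h * (int q - 1)"
    unfolding q_def int_card_field_minus_one ..
  also have "\<dots> = int q * int q ^ h - int q * (int q - 1) ^ h + ((int q - 1) ^ h + (- 1) ^ h * (int q - 1))"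
    by (simp only: power_add power_one_right right_diff_distrib mult_1_right) (simp only: algebra_simps)
  also have "\<dots> = int q * B"
    unfolding psi[symmetric] B_def by (simp only: distrib_left right_diff_distrib)
  finally have E: "int q ^ (h + 1) - int (q - 1) ^ (h + 1) + (- 1) ^ h * int (q - 1) = int q * B" .
  have "real q powi (int m - 1) * real q = real q ^ m" for m
    using power_int_diff[of "real q" "int m" 1] q0 by simp
  from this[of "k - h"] have P: "real q powi (int k - int h - 1) * real q = real q ^ (k - h)"
    unfolding of_nat_diff[OF assms(2)] .
  have "int (card (D1 h k :: (nat \<Rightarrow> 'a) set)) + 1 = int q ^ (k - h) * B"
    using card_D1[OF assms, of "TYPE('a)"] unfolding B_def q_def int_card_field_minus_one .
  then have "real_of_int (int (card (D1 h k :: (nat \<Rightarrow> 'a) set)) + 1) = real_of_int (int q ^ (k - h) * B)"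
    by (rule arg_cong)
  then have "real (card (D1 h k :: (nat \<Rightarrow> 'a) set)) + 1 = real q ^ (k - h) * real_of_int B"
    by simp
  also have "\<dots> = real q powi (int k - int h - 1) * real_of_int (int q * B)"
    unfolding P[symmetric] of_int_mult of_int_of_nat_eq by (rule mult.assoc)
  finally show ?thesis
    unfolding q_def[symmetric] E by linarith
qed

lemma value_partition_nonzero_obtain:
  fixes a :: "nat \<Rightarrow> 'a::{finite,field}"
  assumes "value_partition h a = mset rs" "1 \<le> sum_list rs"
  obtains j where "j < h" "a j \<noteq> 0"
proof -
  have "card {i. i < h \<and> a i \<noteq> 0} = sum_list rs"
    using sum_value_partition[of h a] assms(1) by (simp add: sum_mset_sum_list)
  then have "{i. i < h \<and> a i \<noteq> 0} \<noteq> {}"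
    using assms(2) by (metis card.empty not_one_le_zero)
  then show ?thesis using that by blast
qed

lemma value_partition_list_obtain:
  fixes a :: "nat \<Rightarrow> 'a::{finite,field}"
  assumes "j < h" "a j \<noteq> 0"
  obtains rs where "value_partition h a = mset rs" "rs \<noteq> []" "\<forall>r\<in>set rs. 0 < r"
    "1 \<le> sum_list rs" "sum_list rs \<le> h" "length rs \<le> card (UNIV :: 'a set) - 1"
proof -
  obtain rs where rs: "mset rs = value_partition h a" using ex_mset by blast
  have s: "sum_list rs = card {i. i < h \<and> a i \<noteq> 0}"
    using sum_value_partition[of h a] by (simp add: rs[symmetric] sum_mset_sum_list)
  have "j \<in> {i. i < h \<and> a i \<noteq> 0}" using assms by simp
  then have "0 < sum_list rs" unfolding s card_gt_0_iff by auto
  moreover from this have "rs \<noteq> []" by auto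
  moreover have "sum_list rs \<le> card {..<h}" unfolding s by (rule card_mono) auto
  moreover have "\<forall>r\<in>#value_partition h a. 0 < r"
    unfolding value_partition_fiber_sizes by simp
  then have "\<forall>r\<in>set rs. 0 < r" unfolding rs[symmetric] set_mset_mset .
  moreover have "length rs \<le> card (UNIV :: 'a set) - 1"
    using size_value_partition[of h a] unfolding rs[symmetric] size_mset card_field_minus_zero .
  ultimately show ?thesis using rs by (intro that[of rs]) simp_all
qed

text \<open>In the spectrum the bound l <= q - 1 singles out the partitions that occur, since the
  parts belong to distinct nonzero values; for longer tuples the last binomial coefficient of the
  frequency is 0. The weight X comes from forms with a coordinate beyond the first h, so it is
  listed only for h < k.\<close>

theorem theorem2p5:
  fixes T :: "'a::{finite,field} itself" and h k :: nat
  defines "q \<equiv> card (UNIV :: 'a set)"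
  defines "D \<equiv> (D1 h k :: (nat \<Rightarrow> 'a) set)"
  defines "n \<equiv> card D"
  defines "X \<equiv> real n - real q powi (int k - int h - 1)
                   * real_of_int (int q ^ h + psi T h - int (q - 1) ^ h) + 1"
  defines "Y \<equiv> (\<lambda>s rs. real n - real q ^ (k - 1)
                   + real (q - 1) ^ (h - s) * real q ^ (k - h) * real_of_int (psi T s)
                   - real q ^ (k - h) * real_of_int (A_ext T rs (h - s)) + 1)"
  assumes "4 \<le> h" and "h \<le> k"
  shows "real n = real q powi (int k - int h - 1)
                  * real_of_int (int q ^ (h + 1) - int (q - 1) ^ (h + 1) + (-1) ^ h * int (q - 1)) - 1
    \<and> {real (weight D c) | c. c \<in> code k D \<and> c \<noteq> codeword k D (\<lambda>_. 0)}
        = (if h < k then {X} else {})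
          \<union> {Y s rs | s rs. 1 \<le> s \<and> s \<le> h \<and> rs \<noteq> [] \<and> (\<forall>r\<in>set rs. 0 < r)
                 \<and> sum_list rs = s \<and> length rs \<le> q - 1}
    \<and> card {c. \<exists>a\<in>vecs k. c = codeword k D a \<and> (\<exists>i. h \<le> i \<and> i < k \<and> a i \<noteq> 0)} = q ^ k - q ^ h
    \<and> (\<forall>a\<in>vecs k. (\<exists>i. h \<le> i \<and> i < k \<and> a i \<noteq> 0)
          \<longrightarrow> codeword k D a \<noteq> codeword k D (\<lambda>_. 0) \<and> real (weight D (codeword k D a)) = X)
    \<and> (\<forall>s rs. 1 \<le> s \<and> s \<le> h \<and> rs \<noteq> [] \<and> (\<forall>r\<in>set rs. 0 < r) \<and> sum_list rs = s \<longrightarrow>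
          card {c. \<exists>a\<in>vecs k. c = codeword k D a \<and> (\<forall>i. h \<le> i \<longrightarrow> a i = 0)
                     \<and> value_partition h a = mset rs}
            = (h choose s) * multinomial s rs * multinomial (length rs) (tuple_type rs)
                * ((q - 1) choose (length rs))
          \<and> (\<forall>a\<in>vecs k. (\<forall>i. h \<le> i \<longrightarrow> a i = 0) \<and> value_partition h a = mset rs
                \<longrightarrow> codeword k D a \<noteq> codeword k D (\<lambda>_. 0)
                    \<and> real (weight D (codeword k D a)) = Y s rs))"
proof -
  note hk = \<open>h \<le> k\<close>
  have h1: "1 \<le> h" and h2: "2 \<le> h" using \<open>4 \<le> h\<close> by simp_all
  have inj: "inj_on (codeword k D) (vecs k)"
    unfolding D_def by (rule inj_on_codeword[OF h2 hk])
  have zero: "(\<lambda>_. 0) \<in> vecs k" by (simp add: vecs_def)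
  have nonzero: "codeword k D a \<noteq> codeword k D (\<lambda>_. 0)" if "a \<in> vecs k" "a j \<noteq> 0" for a j
    using inj_onD[OF inj _ that(1) zero] that(2) by auto

  have arith_X: "w = n' - p * (x + z - y) + 1" if "w = n' + 1 - p * (x - y + z)"
    for w n' p x y z :: real
    using that by (simp add: algebra_simps)
  have arith_Y: "w = n' - x + c * b * d - b * e + 1" if "w = n' + 1 - x + b * (c * d) - b * e"
    for w n' x b c d e :: real
    using that by (simp add: mult_ac)
  note of_ints = of_int_add of_int_diff of_int_mult of_int_power of_int_of_nat_eq of_int_1

  have outside: "real (weight D (codeword k D a)) = X" if "h \<le> j" "j < k" "a j \<noteq> 0" for a j
  proof -
    \<comment> \<open>A nonzero coefficient beyond the first h forces h < k, so truncated
      subtraction agrees with the integer exponent.\<close>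
    have "int k - int h - 1 = int (k - h - 1)" using that by simp
    then have powi: "real q powi (int k - int h - 1) = real q ^ (k - h - 1)"
      by (simp only: power_int_of_nat)
    show ?thesis
      using arg_cong[OF weight_codeword_outside[where a = a and j = j, OF h1 that, of T], of real_of_int]
      unfolding X_def powi unfolding n_def D_def q_def of_ints by (rule arith_X)
  qed

  have inside: "real (weight D (codeword k D a)) = Y (sum_list rs) rs"
    if "\<forall>i\<ge>h. a i = 0" "value_partition h a = mset rs" "rs \<noteq> []" "1 \<le> sum_list rs" for a rs
    using arg_cong[OF weight_codeword_value_partition[OF hk that, of T], of real_of_int]
    unfolding Y_def n_def D_def q_def of_ints by (rule arith_Y)

  have card_outside: "card {c. \<exists>a\<in>vecs k. c = codeword k D a \<and> (\<exists>i. h \<le> i \<and> i < k \<and> a i \<noteq> 0)}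
      = q ^ k - q ^ h"
  proof -
    have "a \<in> vecs k \<and> (\<exists>i. h \<le> i \<and> i < k \<and> a i \<noteq> 0) \<longleftrightarrow> a \<in> vecs k - vecs h" for a :: "nat \<Rightarrow> 'a"
      unfolding vecs_def by (auto simp: not_le) (metis not_le)
    then have "{c. \<exists>a\<in>vecs k. c = codeword k D a \<and> (\<exists>i. h \<le> i \<and> i < k \<and> a i \<noteq> 0)}
        = codeword k D ` (vecs k - vecs h)"
      by blast
    moreover have "card (codeword k D ` (vecs k - vecs h)) = card (vecs k - vecs h :: (nat \<Rightarrow> 'a) set)"
      by (rule card_image[OF inj_on_subset[OF inj Diff_subset]])
    moreover have "card (vecs k - vecs h :: (nat \<Rightarrow> 'a) set) = q ^ k - q ^ h"
      unfolding q_def card_vecs[symmetric] by (rule card_Diff_subset[OF finite_vecs vecs_mono[OF hk]])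
    ultimately show ?thesis by (simp only:)
  qed

  have card_inside: "card {c. \<exists>a\<in>vecs k. c = codeword k D a \<and> (\<forall>i. h \<le> i \<longrightarrow> a i = 0)
        \<and> value_partition h a = mset rs}
      = (h choose s) * multinomial s rs * multinomial (length rs) (tuple_type rs)
        * ((q - 1) choose (length rs))"
    if "\<forall>r\<in>set rs. 0 < r" "s \<le> h" "sum_list rs = s" for s rs
  proof -
    let ?V = "{a \<in> vecs h. value_partition h (a :: nat \<Rightarrow> 'a) = mset rs}"
    have "a \<in> vecs k \<and> (\<forall>i. h \<le> i \<longrightarrow> a i = 0) \<longleftrightarrow> a \<in> vecs h" for a :: "nat \<Rightarrow> 'a"
      using hk by (auto simp: vecs_def)
    then have "{c. \<exists>a\<in>vecs k. c = codeword k D a \<and> (\<forall>i. h \<le> i \<longrightarrow> a i = 0)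
        \<and> value_partition h a = mset rs} = codeword k D ` ?V"
      by blast
    moreover have "?V \<subseteq> vecs k" using vecs_mono[OF hk] by blast
    then have "card (codeword k D ` ?V) = card ?V"
      by (intro card_image inj_on_subset[OF inj])
    ultimately show ?thesis
      unfolding card_vecs_value_partition card_value_partition[OF that(1,2)[folded that(3)]] that(3) q_def
      by (simp only:)
  qed

  have spectrum: "{real (weight D c) | c. c \<in> code k D \<and> c \<noteq> codeword k D (\<lambda>_. 0)}
        = (if h < k then {X} else {})
          \<union> {Y s rs | s rs. 1 \<le> s \<and> s \<le> h \<and> rs \<noteq> [] \<and> (\<forall>r\<in>set rs. 0 < r)
                 \<and> sum_list rs = s \<and> length rs \<le> q - 1}" (is "?W = ?X \<union> ?Y")
  proof (intro equalityI subsetI)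
    fix w assume "w \<in> ?W"
    then obtain a where a: "a \<in> vecs k" "codeword k D a \<noteq> codeword k D (\<lambda>_. 0)"
      and w: "w = real (weight D (codeword k D a))"
      by (auto simp: code_def)
    show "w \<in> ?X \<union> ?Y"
    proof (cases "\<exists>j. h \<le> j \<and> j < k \<and> a j \<noteq> 0")
      case True
      then show ?thesis using outside[of _ a] w by auto
    next
      case False
      then have a0: "\<forall>i\<ge>h. a i = 0" using a(1) by (auto simp: vecs_def not_less[symmetric])
      have "a \<noteq> (\<lambda>_. 0)" using a(2) by blast
      then obtain j where j: "a j \<noteq> 0" by blast
      with a0 have "j < h" by (metis not_le)
      then obtain rs where rs: "value_partition h a = mset rs" "rs \<noteq> []" "\<forall>r\<in>set rs. 0 < r"
        "1 \<le> sum_list rs" "sum_list rs \<le> h" "length rs \<le> card (UNIV :: 'a set) - 1"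
        using j by (rule value_partition_list_obtain)
      have "w = Y (sum_list rs) rs" unfolding w by (rule inside[OF a0 rs(1,2,4)])
      then have "w \<in> ?Y" using rs(2-6) unfolding q_def by blast
      then show ?thesis by blast
    qed
  next
    fix w assume "w \<in> ?X \<union> ?Y"
    moreover have weight_in: "real (weight D (codeword k D a)) \<in> ?W"
      if "a \<in> vecs k" "codeword k D a \<noteq> codeword k D (\<lambda>_. 0)" for a
      unfolding code_def using that by (intro CollectI exI[of _ "codeword k D a"] conjI refl imageI)
    ultimately show "w \<in> ?W"
    proof (elim UnE)
      assume "w \<in> ?X"
      then have w: "w = X" "h < k" by (auto split: if_splits)
      \<comment> \<open>The form x_{h+1}, the simplest one that involves a coordinate beyond the
        first h.\<close>
      define a where "a i = (if i = h then 1 else 0 :: 'a)" for i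
      have "a \<in> vecs k" "a h \<noteq> 0" using w by (auto simp: a_def vecs_def)
      then show ?thesis
        using outside[of h a] weight_in[of a] nonzero[of a h] w by auto
    next
      assume "w \<in> ?Y"
      then obtain rs where w: "w = Y (sum_list rs) rs" and rs: "1 \<le> sum_list rs" "sum_list rs \<le> h"
        "rs \<noteq> []" "\<forall>r\<in>set rs. 0 < r" "length rs \<le> card (UNIV :: 'a set) - 1"
        unfolding q_def by blast
      obtain f :: "nat \<Rightarrow> 'a" where f: "value_partition h f = mset rs"
        using value_partition_exists[OF rs(4,2,5)] by blast
      \<comment> \<open>\<open>f\<close> is uncontrolled from index h on, whereas a vector supported
        on the first h coordinates is wanted; the value partition looks only below h.\<close>
      define a where "a i = (if i < h then f i else 0)" for i
      have vp: "value_partition h a = mset rs"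
        unfolding f[symmetric] by (rule value_partition_cong) (simp add: a_def)
      have a0: "\<forall>i\<ge>h. a i = 0" by (simp add: a_def)
      then have ak: "a \<in> vecs k" using hk by (simp add: vecs_def)
      obtain j where "a j \<noteq> 0" by (rule value_partition_nonzero_obtain[OF vp rs(1)])
      from weight_in[OF ak nonzero[OF ak this]] show ?thesis
        unfolding inside[OF a0 vp rs(3,1)] w .
    qed
  qed
  have length: "real n = real q powi (int k - int h - 1)
      * real_of_int (int q ^ (h + 1) - int (q - 1) ^ (h + 1) + (-1) ^ h * int (q - 1)) - 1"
    unfolding n_def D_def q_def by (rule card_D1_closed_form[OF h1 hk])
  have outside_all: "\<forall>a\<in>vecs k. (\<exists>i. h \<le> i \<and> i < k \<and> a i \<noteq> 0)
      \<longrightarrow> codeword k D a \<noteq> codeword k D (\<lambda>_. 0) \<and> real (weight D (codeword k D a)) = X"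
    using nonzero outside by blast
  have inside_all: "\<forall>a\<in>vecs k. (\<forall>i. h \<le> i \<longrightarrow> a i = 0) \<and> value_partition h a = mset rs
      \<longrightarrow> codeword k D a \<noteq> codeword k D (\<lambda>_. 0) \<and> real (weight D (codeword k D a)) = Y s rs"
    if rs: "1 \<le> s" "rs \<noteq> []" "sum_list rs = s" for s rs
  proof (intro ballI impI, elim conjE)
    fix a :: "nat \<Rightarrow> 'a" assume a: "a \<in> vecs k" "\<forall>i\<ge>h. a i = 0" "value_partition h a = mset rs"
    obtain j where "a j \<noteq> 0"
      by (rule value_partition_nonzero_obtain[OF a(3) rs(1)[folded rs(3)]])
    from nonzero[OF a(1) this] inside[OF a(2,3) rs(2) rs(1)[folded rs(3)]]
    show "codeword k D a \<noteq> codeword k D (\<lambda>_. 0) \<and> real (weight D (codeword k D a)) = Y s rs"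
      unfolding rs(3) by (rule conjI)
  qed
  show ?thesis
    by (intro conjI allI impI)
      (rule length spectrum card_outside outside_all | (elim conjE, rule card_inside inside_all; assumption))+
qed

end
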